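(* There is a quadratic time algorithm that, given a $\Pi_m\Sigma_2\Pi_t$ polynomial, decides whether it has a multilinear monomial in its sum-product expansion.
   Context: Polynomials are in variables $x_1,\dots,x_n$. A monomial is multilinear if every variable occurring in it has exponent $1$. A $\Pi_m\Sigma_2\Pi_t$ polynomial is given as a product $f_1\cdots f_m$ of $m$ clauses, each clause a sum of at most $2$ terms, each term a product of variables of degree at most $t$. The monomials of its sum-product expansion are the products obtained by choosing one term from each clause; it has a multilinear monomial in its sum-product expansion if some such product is multilinear. Quadratic time means quadratic in the size of the input representation. *)

theory Defs
  imports Main "HOL-Library.Multiset"
begin

text \<open>
  A word RAM with word length \<open>w\<close>. A state consists of registers, which a program addresses
  only by constants, and of a memory, which is addressed by computed words. All arithmetic is on
  words, i.e. numbers below \<open>2 ^ w\<close>: addition wraps around, subtraction stops at \<open>0\<close>.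
  There is no multiplication. The control flow is structured; a program is a fixed finite object,
  so each construct stands for a bounded number of ordinary RAM instructions, and every operator
  evaluated and every command executed is charged one time unit.
\<close>

type_synonym state = "(nat \<Rightarrow> nat) \<times> (nat \<Rightarrow> nat)"

datatype aexp =
    Const nat
  | Reg nat
  | Load aexp
  | Plus aexp aexp
  | Monus aexp aexp

datatype bexp =
    Less aexp aexp
  | Equal aexp aexp
  | Neg bexp
  | Conj bexp bexp

datatype com =
    Nop
  | Assign nat aexp
  | Store aexp aexp
  | Seq com com
  | Cond bexp com com
  | Loop bexp com

fun aval :: "nat \<Rightarrow> aexp \<Rightarrow> state \<Rightarrow> nat" where
  "aval w (Const k) s = k mod 2 ^ w"
| "aval w (Reg r) s = fst s r"
| "aval w (Load a) s = snd s (aval w a s)"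
| "aval w (Plus a b) s = (aval w a s + aval w b s) mod 2 ^ w"
| "aval w (Monus a b) s = aval w a s - aval w b s"

fun bval :: "nat \<Rightarrow> bexp \<Rightarrow> state \<Rightarrow> bool" where
  "bval w (Less a b) s \<longleftrightarrow> aval w a s < aval w b s"
| "bval w (Equal a b) s \<longleftrightarrow> aval w a s = aval w b s"
| "bval w (Neg b) s \<longleftrightarrow> \<not> bval w b s"
| "bval w (Conj b c) s \<longleftrightarrow> bval w b s \<and> bval w c s"

fun acost :: "aexp \<Rightarrow> nat" where
  "acost (Const k) = 1"
| "acost (Reg r) = 1"
| "acost (Load a) = 1 + acost a"
| "acost (Plus a b) = 1 + acost a + acost b"
| "acost (Monus a b) = 1 + acost a + acost b"

fun bcost :: "bexp \<Rightarrow> nat" where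
  "bcost (Less a b) = 1 + acost a + acost b"
| "bcost (Equal a b) = 1 + acost a + acost b"
| "bcost (Neg b) = 1 + bcost b"
| "bcost (Conj b c) = 1 + bcost b + bcost c"

text \<open>\<open>exec w P s T s'\<close>: started in \<open>s\<close>, the program \<open>P\<close> halts in \<open>s'\<close> after \<open>T\<close> time units.\<close>

inductive exec :: "nat \<Rightarrow> com \<Rightarrow> state \<Rightarrow> nat \<Rightarrow> state \<Rightarrow> bool" for w :: nat where
  exec_Nop: "exec w Nop s 1 s"
| exec_Assign:
    "exec w (Assign r a) s (1 + acost a) ((fst s)(r := aval w a s), snd s)"
| exec_Store:
    "exec w (Store a b) s (1 + acost a + acost b)
       (fst s, (snd s)(aval w a s := aval w b s))"
| exec_Seq:
    "exec w P s T s' \<Longrightarrow> exec w Q s' T' s'' \<Longrightarrow> exec w (Seq P Q) s (1 + T + T') s''"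
| exec_Cond_True:
    "bval w b s \<Longrightarrow> exec w P s T s' \<Longrightarrow> exec w (Cond b P Q) s (1 + bcost b + T) s'"
| exec_Cond_False:
    "\<not> bval w b s \<Longrightarrow> exec w Q s T s' \<Longrightarrow> exec w (Cond b P Q) s (1 + bcost b + T) s'"
| exec_Loop_True:
    "bval w b s \<Longrightarrow> exec w P s T s' \<Longrightarrow> exec w (Loop b P) s' T' s''
       \<Longrightarrow> exec w (Loop b P) s (1 + bcost b + T + T') s''"
| exec_Loop_False:
    "\<not> bval w b s \<Longrightarrow> exec w (Loop b P) s (1 + bcost b) s"

lemma exec_deterministic:
  assumes "exec w P s T s'" and "exec w P s U s''"
  shows "T = U \<and> s' = s''"
  using assms
proof (induction arbitrary: U s'' rule: exec.induct)
  case (exec_Nop s)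
  then show ?case by (auto elim: exec.cases)
next
  case (exec_Assign r a s)
  then show ?case by (auto elim: exec.cases)
next
  case (exec_Store a b s)
  then show ?case by (auto elim: exec.cases)
next
  case (exec_Seq P s T s' Q T' s'')
  from exec_Seq.prems show ?case
    by (cases rule: exec.cases) (use exec_Seq.IH in blast)
next
  case (exec_Cond_True b s P T s' Q)
  from exec_Cond_True.prems show ?case
    by (cases rule: exec.cases) (use exec_Cond_True in blast)+
next
  case (exec_Cond_False b s Q T s' P)
  from exec_Cond_False.prems show ?case
    by (cases rule: exec.cases) (use exec_Cond_False in blast)+
next
  case (exec_Loop_True b s P T s' T' s'')
  from exec_Loop_True.prems show ?case
    by (cases rule: exec.cases) (use exec_Loop_True in blast)+
next
  case (exec_Loop_False b s P)
  from exec_Loop_False.prems show ?case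
    by (cases rule: exec.cases) (use exec_Loop_False in blast)+
qed

text \<open>The input occupies the first memory cells, its length is in register 0; all else is 0.\<close>

definition init_state :: "nat list \<Rightarrow> state" where
  "init_state xs =
     ((\<lambda>r. if r = 0 then length xs else 0), (\<lambda>i. if i < length xs then xs ! i else 0))"

text \<open>
  \<open>P\<close> decides \<open>Q\<close> on the inputs in \<open>D\<close>, encoded by \<open>enc\<close>, within time \<open>f N\<close>, where
  \<open>N\<close> is the number of input words; the answer is left in register 0. As usual for the word RAM,
  the word length only has to be large enough to hold each input word and to be at least
  \<open>k * log 2 (N + 2)\<close> for a constant \<open>k\<close> that is independent of the input. The time bound does
  not depend on the word length.
\<close>

definition decides_in_time ::
  "com \<Rightarrow> ('a \<Rightarrow> nat list) \<Rightarrow> 'a set \<Rightarrow> ('a \<Rightarrow> bool) \<Rightarrow> (nat \<Rightarrow> nat) \<Rightarrow> bool" where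
  "decides_in_time P enc D Q f \<longleftrightarrow>
     (\<exists>k. \<forall>x\<in>D. \<forall>w.
        (\<forall>a\<in>set (enc x). a < 2 ^ w) \<and> (length (enc x) + 2) ^ k \<le> 2 ^ w \<longrightarrow>
        (\<exists>T s. exec w P (init_state (enc x)) T s \<and> T \<le> f (length (enc x)) \<and>
               fst s 0 = (if Q x then 1 else 0)))"

definition quadratic_time_decidable ::
  "('a \<Rightarrow> nat list) \<Rightarrow> 'a set \<Rightarrow> ('a \<Rightarrow> bool) \<Rightarrow> bool" where
  "quadratic_time_decidable enc D Q \<longleftrightarrow>
     (\<exists>P c. decides_in_time P enc D Q (\<lambda>N. c * N ^ 2))"

text \<open>
  The variable \<open>x\<^sub>i\<close> is represented by \<open>i\<close>; a term is the list of its factors, with repetitions, a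
  clause the list of its summands, and a polynomial the list of its clauses. A monomial is the
  multiset of its variables, the multiplicity of a variable being its exponent.
\<close>

type_synonym pterm = "nat list"
type_synonym clause = "pterm list"
type_synonym psp = "clause list"
type_synonym monomial = "nat multiset"

definition pi_sigma_pi :: "nat \<Rightarrow> nat \<Rightarrow> nat \<Rightarrow> nat \<Rightarrow> psp set" where
  "pi_sigma_pi n m s t =
     {p. length p = m \<and>
         (\<forall>f\<in>set p. length f \<le> s \<and> (\<forall>T\<in>set f. length T \<le> t \<and> set T \<subseteq> {1..n}))}"

definition multilinear :: "monomial \<Rightarrow> bool" where
  "multilinear M \<longleftrightarrow> (\<forall>x\<in>#M. count M x = 1)"

text \<open>\<open>product_lists p\<close> lists all ways of choosing one term from each clause of \<open>p\<close>.\<close>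

definition expansion :: "psp \<Rightarrow> monomial list" where
  "expansion p = map (\<lambda>ts. \<Sum>T\<leftarrow>ts. mset T) (product_lists p)"

definition has_multilinear_monomial :: "psp \<Rightarrow> bool" where
  "has_multilinear_monomial p \<longleftrightarrow> (\<exists>M\<in>set (expansion p). multilinear M)"

definition encode_term :: "pterm \<Rightarrow> nat list" where
  "encode_term T = length T # T"

definition encode_clause :: "clause \<Rightarrow> nat list" where
  "encode_clause f = length f # concat (map encode_term f)"

definition encode :: "psp \<Rightarrow> nat list" where
  "encode p = length p # concat (map encode_clause p)"

end

theory Submission
  imports Defs
begin

text \<open>
  Choosing a term from every clause so that no variable is used twice is a 2-satisfiability problem:
  choosing a term excludes every other term with which it shares a variable, and excluding a term
  forces the other term of its clause. It is unsolvable iff for both terms of some clause the choice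
  leads, through a chain of forced choices, to the exclusion of that same term.

  A variable with many occurrences yields quadratically many conflicts, too many to be explored from
  every term. Linking each occurrence only to the previous occurrence of its variable, with one
  auxiliary node for ``this occurrence and all later ones are excluded'' and one for ``this occurrence
  and all earlier ones are excluded'', represents the same conflicts by a graph with linearly many
  nodes of out-degree at most three. Building it takes quadratic time by comparing all pairs of
  occurrences, and one breadth-first search from each position takes linear time.
\<close>

section \<open>Running time of word RAM programs\<close>

text \<open>Two features go beyond the textbook form of 2-satisfiability. A term that repeats a
  variable conflicts with itself, so conflicts relate distinct occurrences and not distinct terms;
  and in a one-term clause the term is its own mate, so that excluding it forces it. Both are
  absorbed by measuring failure through an exclusion being reached, never through the mate being
  reached.

  The chains of auxiliary nodes are sound because the choice of an occurrence enters them only at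
  the strictly next or strictly previous occurrence, and because the two directions never mix: a
  chain entered at the occurrence itself, or one that could be walked both ways, would exclude the
  very term that was chosen.

  Searches may start at every position, term or not, since an exclusion node has incoming edges only
  if it belongs to a term. Empty clauses leave no trace in the graph and are recorded by a
  flag.\<close>

definition runs :: "nat \<Rightarrow> com \<Rightarrow> state \<Rightarrow> nat \<Rightarrow> state \<Rightarrow> bool" where
  "runs w c s t s' \<longleftrightarrow> (\<exists>T\<le>t. exec w c s T s')"

lemma runs_mono: "runs w c s t s' \<Longrightarrow> t \<le> t' \<Longrightarrow> runs w c s t' s'"
  unfolding runs_def by (meson le_trans)

lemma runs_Nop: "runs w Nop s 1 s"
  unfolding runs_def using exec_Nop by blast

lemma runs_Seq:
  assumes "runs w P s t s'" and "runs w Q s' t' s''"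
  shows "runs w (Seq P Q) s (1 + t + t') s''"
proof -
  obtain T T' where "T \<le> t" "exec w P s T s'" "T' \<le> t'" "exec w Q s' T' s''"
    using assms unfolding runs_def by blast
  then show ?thesis
    unfolding runs_def using exec_Seq add_mono by (metis add_left_mono add.assoc)
qed

text \<open>Every round lowers \<open>\<mu>\<close>, possibly by more than one, so there are at most
  \<open>\<mu> s\<close> rounds; the last summands pay for the final failing test.\<close>

lemma runs_Loop:
  assumes step: "\<And>s. I s \<Longrightarrow> bval w b s \<Longrightarrow> \<exists>s'. runs w P s t s' \<and> I s' \<and> \<mu> s' < (\<mu> s :: nat)"
    and "I s"
  shows "\<exists>s'. runs w (Loop b P) s (\<mu> s * (1 + bcost b + t) + 1 + bcost b) s' \<and> I s' \<and> \<not> bval w b s'"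
  using \<open>I s\<close>
proof (induction "\<mu> s" arbitrary: s rule: less_induct)
  case less
  show ?case
  proof (cases "bval w b s")
    case False
    then have "runs w (Loop b P) s (\<mu> s * (1 + bcost b + t) + 1 + bcost b) s"
      unfolding runs_def by (intro exI[of _ "1 + bcost b"]) (simp add: exec_Loop_False[OF False, simplified])
    with False less.prems show ?thesis by blast
  next
    case True
    obtain s' where s': "runs w P s t s'" "I s'" "\<mu> s' < \<mu> s"
      using step[OF less.prems True] by blast
    obtain T where T: "T \<le> t" "exec w P s T s'"
      using s'(1) unfolding runs_def by blast
    obtain s'' T' where s'': "T' \<le> \<mu> s' * (1 + bcost b + t) + 1 + bcost b"
        "exec w (Loop b P) s' T' s''" "I s''" "\<not> bval w b s''"
      using less.hyps[OF s'(3,2)] unfolding runs_def by blast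
    have "Suc (\<mu> s') * (1 + bcost b + t) \<le> \<mu> s * (1 + bcost b + t)"
      using s'(3) by (intro mult_right_mono) auto
    then have "1 + bcost b + T + T' \<le> \<mu> s * (1 + bcost b + t) + 1 + bcost b"
      using T(1) s''(1) by simp
    moreover have "exec w (Loop b P) s (1 + bcost b + T + T') s''"
      using True T(2) s''(2) by (rule exec_Loop_True)
    ultimately show ?thesis
      using s''(3,4) unfolding runs_def by blast
  qed
qed

definition loop_time :: "bexp \<Rightarrow> nat \<Rightarrow> nat \<Rightarrow> nat" where
  "loop_time b n t = n * (1 + bcost b + t) + 1 + bcost b"

lemma runs_bounded_Loop:
  assumes "\<And>s. I s \<Longrightarrow> bval w b s \<Longrightarrow> \<exists>s'. runs w P s t s' \<and> I s' \<and> \<mu> s' < (\<mu> s :: nat)"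
    and "I s" and "\<mu> s \<le> n"
  shows "\<exists>s'. runs w (Loop b P) s (loop_time b n t) s' \<and> I s' \<and> \<not> bval w b s'"
proof -
  have "\<mu> s * (1 + bcost b + t) + 1 + bcost b \<le> loop_time b n t"
    unfolding loop_time_def using assms(3) by (intro add_right_mono mult_right_mono) simp_all
  then show ?thesis
    using runs_Loop[where I = I and \<mu> = \<mu>, OF assms(1,2)] runs_mono by blast
qed

section \<open>Loop-free programs as functions on states\<close>

fun loop_free :: "com \<Rightarrow> bool" where
  "loop_free (Seq P Q) \<longleftrightarrow> loop_free P \<and> loop_free Q"
| "loop_free (Cond b P Q) \<longleftrightarrow> loop_free P \<and> loop_free Q"
| "loop_free (Loop b P) \<longleftrightarrow> False"
| "loop_free _ \<longleftrightarrow> True"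

text \<open>Without loops a program always halts, so its effect is a function that the simplifier
  can evaluate; the value at \<open>Loop\<close> is a dummy.\<close>

fun run :: "nat \<Rightarrow> com \<Rightarrow> state \<Rightarrow> state" where
  "run w Nop s = s"
| "run w (Assign r a) s = ((fst s)(r := aval w a s), snd s)"
| "run w (Store a b) s = (fst s, (snd s)(aval w a s := aval w b s))"
| "run w (Seq P Q) s = run w Q (run w P s)"
| "run w (Cond b P Q) s = (if bval w b s then run w P s else run w Q s)"
| "run w (Loop b P) s = s"

text \<open>Charging both branches of a conditional loses only a constant factor and avoids
  maxima.\<close>

fun max_time :: "com \<Rightarrow> nat" where
  "max_time Nop = 1"
| "max_time (Assign r a) = 1 + acost a"
| "max_time (Store a b) = 1 + acost a + acost b"
| "max_time (Seq P Q) = 1 + max_time P + max_time Q"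
| "max_time (Cond b P Q) = 1 + bcost b + max_time P + max_time Q"
| "max_time (Loop b P) = 0"

lemma runs_run: "loop_free c \<Longrightarrow> runs w c s (max_time c) (run w c s)"
proof (induction c arbitrary: s)
  case Nop
  show ?case unfolding runs_def by (auto intro!: exI[of _ 1] exec_Nop[simplified])
next
  case (Assign r a)
  then show ?case unfolding runs_def by (auto intro!: exI[of _ "1 + acost a"] exec_Assign[simplified])
next
  case (Store a b)
  then show ?case unfolding runs_def by (auto intro!: exI[of _ "1 + acost a + acost b"] exec_Store[simplified])
next
  case (Seq P Q)
  then show ?case using runs_Seq[of w P s "max_time P" "run w P s" Q "max_time Q" "run w Q (run w P s)"]
    by simp
next
  case (Cond b P Q)
  show ?case
  proof (cases "bval w b s")
    case True
    obtain T where "T \<le> max_time P" "exec w P s T (run w P s)"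
      using Cond unfolding runs_def by (metis loop_free.simps(2))
    then show ?thesis
      using True unfolding runs_def
      by (intro exI[of _ "1 + bcost b + T"]) (auto dest: exec_Cond_True[OF True])
  next
    case False
    obtain T where "T \<le> max_time Q" "exec w Q s T (run w Q s)"
      using Cond unfolding runs_def by (metis loop_free.simps(2))
    then show ?thesis
      using False unfolding runs_def
      by (intro exI[of _ "1 + bcost b + T"]) (auto dest: exec_Cond_False[OF False])
  qed
qed simp

text \<open>The restriction to positive \<open>n\<close> allows constants at every degree, as
  \<open>0 ^ d = 0\<close> for \<open>d > 0\<close>; an encoded input is never empty.\<close>

definition poly_bounded :: "nat \<Rightarrow> (nat \<Rightarrow> nat) \<Rightarrow> bool" where
  "poly_bounded d f \<longleftrightarrow> (\<exists>c. \<forall>n>0. f n \<le> c * n ^ d)"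

lemma poly_bounded_const: "poly_bounded d (\<lambda>n. k)"
  unfolding poly_bounded_def by (rule exI[of _ k]) simp

lemma poly_bounded_add:
  assumes "poly_bounded d f" and "poly_bounded d g"
  shows "poly_bounded d (\<lambda>n. f n + g n)"
proof -
  obtain a b where ab: "\<forall>n>0. f n \<le> a * n ^ d" "\<forall>n>0. g n \<le> b * n ^ d"
    using assms unfolding poly_bounded_def by blast
  then have "f n + g n \<le> (a + b) * n ^ d" if "0 < n" for n
    using that add_mono[of "f n" "a * n ^ d" "g n" "b * n ^ d"] by (simp add: add_mult_distrib)
  then show ?thesis unfolding poly_bounded_def by blast
qed

text \<open>A linear number of rounds raises the degree by one; the factor \<open>k\<close> covers
  the searches, which run over \<open>4 * N\<close> nodes.\<close>

lemma poly_bounded_loop: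
  assumes "poly_bounded d t"
  shows "poly_bounded (Suc d) (\<lambda>n. loop_time b (k * n) (t n))"
proof -
  obtain c where c: "\<forall>n>0. t n \<le> c * n ^ d"
    using assms unfolding poly_bounded_def by blast
  let ?B = "1 + bcost b"
  have "loop_time b (k * n) (t n) \<le> (k * (?B + c) + ?B) * n ^ Suc d" if n: "0 < n" for n
  proof -
    have one: "1 \<le> n ^ d" "1 \<le> n ^ Suc d" using n by auto
    have "?B + t n \<le> (?B + c) * n ^ d"
      using c[rule_format, OF n] mult_le_mono2[OF one(1), of ?B] by (simp add: add_mult_distrib)
    then have "k * n * (?B + t n) \<le> k * n * ((?B + c) * n ^ d)"
      by (rule mult_le_mono2)
    moreover have "?B \<le> ?B * n ^ Suc d"
      using mult_le_mono2[OF one(2), of ?B] by simp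
    ultimately show ?thesis
      unfolding loop_time_def by (simp add: algebra_simps)
  qed
  then show ?thesis unfolding poly_bounded_def by blast
qed

lemma poly_bounded_loop_1: "poly_bounded d t \<Longrightarrow> poly_bounded (Suc d) (\<lambda>n. loop_time b n (t n))"
  using poly_bounded_loop[of d t b 1] by simp

section \<open>2-satisfiability\<close>

text \<open>\<open>K\<close> may be reflexive and \<open>mate\<close> may have fixed points: the
  former covers a term that repeats a variable, the latter a one-term clause.\<close>

locale two_sat =
  fixes H :: "'a set" and mate :: "'a \<Rightarrow> 'a" and K :: "'a \<Rightarrow> 'a \<Rightarrow> bool"
  assumes finite_H: "finite H"
    and mate_in: "h \<in> H \<Longrightarrow> mate h \<in> H"
    and mate_mate: "h \<in> H \<Longrightarrow> mate (mate h) = h"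
    and K_in: "K a b \<Longrightarrow> a \<in> H"
    and K_sym: "K a b \<Longrightarrow> K b a"
begin

text \<open>Choosing \<open>a\<close> excludes each \<open>b\<close> with \<open>K a b\<close>; a clause with a single term has \<open>mate h = h\<close>.\<close>

definition implies :: "('a \<times> 'a) set" where
  "implies = {(a, mate b) | a b. K a b}"

text \<open>Phrased through the last conflict and not as reachability of \<open>mate a\<close>,
  because in a one-term clause \<open>mate a = a\<close> is reachable trivially.\<close>

definition bad :: "'a \<Rightarrow> bool" where
  "bad a \<longleftrightarrow> (\<exists>c. (a, c) \<in> implies\<^sup>* \<and> K c a)"

text \<open>Both terms of a clause may be present: dropping one of them later creates no
  conflict.\<close>

definition solution :: "'a set \<Rightarrow> bool" where
  "solution S \<longleftrightarrow> (\<forall>h\<in>H. h \<in> S \<or> mate h \<in> S) \<and> (\<forall>a\<in>S. \<forall>b\<in>S. \<not> K a b)"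

lemma implies_in: "(a, b) \<in> implies\<^sup>* \<Longrightarrow> a \<in> H \<Longrightarrow> b \<in> H"
  by (induction rule: rtrancl_induct) (auto simp: implies_def intro: mate_in K_in K_sym)

text \<open>The step from \<open>b\<close> to \<open>mate d\<close> comes from \<open>K b d\<close>;
  the same conflict read as \<open>K d b\<close> gives the step from \<open>d\<close> to
  \<open>mate b\<close>, so paths can be reversed.\<close>

lemma implies_contrapositive:
  "(a, b) \<in> implies\<^sup>* \<Longrightarrow> a \<in> H \<Longrightarrow> (mate b, mate a) \<in> implies\<^sup>*"
proof (induction rule: rtrancl_induct)
  case (step b c)
  obtain d where "c = mate d" "K b d" using step.hyps by (auto simp: implies_def)
  moreover from this have "d \<in> H" "K d b" using K_sym K_in by blast+
  ultimately have "(d, mate b) \<in> implies" "mate c = d"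
    using mate_mate by (auto simp: implies_def)
  then show ?case using step by (simp add: converse_rtrancl_into_rtrancl)
qed simp

lemma solution_closed:
  assumes "solution S" and "(a, b) \<in> implies\<^sup>*" and "a \<in> S"
  shows "b \<in> S"
  using assms(2,3)
proof (induction rule: rtrancl_induct)
  case (step b c)
  then obtain d where "c = mate d" "K b d" by (auto simp: implies_def)
  with step assms(1) show ?case
    unfolding solution_def using K_in K_sym by blast
qed

definition partial :: "'a set \<Rightarrow> bool" where
  "partial S \<longleftrightarrow> S \<subseteq> H \<and> implies `` S \<subseteq> S \<and> (\<forall>a\<in>S. \<forall>b\<in>S. \<not> K a b)"

text \<open>
  The closure of a term that does not lead to its own exclusion can be added to a partial solution:
  a conflict with it would, by contraposition, force \<open>mate a\<close>.
\<close>

lemma partial_extend: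
  assumes S: "partial S" and a: "a \<in> H" "\<not> bad a" "mate a \<notin> S"
  shows "partial (S \<union> implies\<^sup>* `` {a})"
proof -
  have no1: False if "b \<in> S" "(a, c) \<in> implies\<^sup>*" "K b c" for b c
  proof -
    have "(b, mate c) \<in> implies" using that by (auto simp: implies_def)
    moreover have "(mate c, mate a) \<in> implies\<^sup>*"
      using that a by (simp add: implies_contrapositive)
    ultimately have "(b, mate a) \<in> implies\<^sup>*" by simp
    then have "mate a \<in> implies\<^sup>* `` S" using that by blast
    moreover have "implies\<^sup>* `` S = S"
      using S by (simp add: partial_def Image_closed_trancl)
    ultimately show False using a by simp
  qed
  have no2: False if "(a, b) \<in> implies\<^sup>*" "(a, c) \<in> implies\<^sup>*" "K b c" for b c
  proof -
    have "(b, mate c) \<in> implies" using that by (auto simp: implies_def)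
    moreover have "(mate c, mate a) \<in> implies\<^sup>*"
      using that a by (simp add: implies_contrapositive)
    \<comment> \<open>This path has at least one step, which matters when \<open>mate a = a\<close>;
      its last step comes from a conflict with some \<open>e\<close> whose mate is
      \<open>mate a\<close>, hence with \<open>a\<close> itself.\<close>
    ultimately have "(a, mate a) \<in> implies\<^sup>+" using that by (meson rtrancl_into_trancl1 trancl_rtrancl_trancl)
    then obtain d where d: "(a, d) \<in> implies\<^sup>*" "(d, mate a) \<in> implies"
      by (meson tranclD2)
    then obtain e where e: "mate e = mate a" "K d e" by (auto simp: implies_def)
    then have "e = a" using a mate_mate K_sym K_in by metis
    then show False using d e a unfolding bad_def by blast
  qed
  show ?thesis
    unfolding partial_def
  proof (intro conjI)
    show "S \<union> implies\<^sup>* `` {a} \<subseteq> H" using S a implies_in by (auto simp: partial_def)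
    show "implies `` (S \<union> implies\<^sup>* `` {a}) \<subseteq> S \<union> implies\<^sup>* `` {a}"
      using S by (auto simp: partial_def intro: rtrancl_into_rtrancl)
    show "\<forall>b\<in>S \<union> implies\<^sup>* `` {a}. \<forall>c\<in>S \<union> implies\<^sup>* `` {a}. \<not> K b c"
      using S no1 no2 unfolding partial_def by (blast intro: K_sym)
  qed
qed

text \<open>A solution is closed under implications, so none of its members is bad, and it meets
  every clause. Conversely a maximal partial solution must meet every clause, since otherwise the
  closure of a term of that clause that is not bad would extend it.\<close>

theorem solvable_iff: "(\<exists>S. solution S) \<longleftrightarrow> \<not> (\<exists>h\<in>H. bad h \<and> bad (mate h))"
proof
  assume "\<exists>S. solution S"
  then obtain S where S: "solution S" by blast
  have "\<not> bad a" if "a \<in> S" for a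
    using solution_closed[OF S _ that] S that unfolding bad_def solution_def by blast
  then show "\<not> (\<exists>h\<in>H. bad h \<and> bad (mate h))"
    using S unfolding solution_def by blast
next
  assume good: "\<not> (\<exists>h\<in>H. bad h \<and> bad (mate h))"
  have "partial {}" by (simp add: partial_def)
  moreover have "finite {S. partial S}"
    by (rule finite_subset[of _ "Pow H"]) (auto simp: partial_def finite_H)
  ultimately obtain S where S: "partial S" and max: "\<And>S'. partial S' \<Longrightarrow> S \<subseteq> S' \<Longrightarrow> S' = S"
    using finite_has_maximal[of "{S. partial S}"] by auto
  have "h \<in> S \<or> mate h \<in> S" if h: "h \<in> H" for h
  proof (rule ccontr)
    assume none: "\<not> (h \<in> S \<or> mate h \<in> S)"
    obtain a where a: "a \<in> {h, mate h}" "\<not> bad a" using good h by blast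
    have "a \<in> H" "a \<notin> S" "mate a \<notin> S"
      using a(1) none h mate_in mate_mate by auto
    with partial_extend[OF S] a(2) have "partial (S \<union> implies\<^sup>* `` {a})" by blast
    then have "S \<union> implies\<^sup>* `` {a} = S" by (rule max) simp
    then show False using \<open>a \<notin> S\<close> by blast
  qed
  then have "solution S" using S by (auto simp: solution_def partial_def)
  then show "\<exists>S. solution S" ..
qed

end

section \<open>The implication graph\<close>

text \<open>
  Terms are identified with the positions of their length fields in the input word. \<open>own q\<close> is the
  term containing the variable at position \<open>q\<close>, and \<open>mate h\<close> is the other term of the clause of \<open>h\<close>;
  both are \<open>0\<close> where this makes no sense.
\<close>

locale layout =
  fixes N :: nat and val own mate :: "nat \<Rightarrow> nat"
  assumes own_less: "own q \<noteq> 0 \<Longrightarrow> 0 < q \<and> q < N"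
    and own_pred: "own q \<noteq> 0 \<Longrightarrow> (if own (q - 1) = 0 then q - 1 else own (q - 1)) = own q"
    and mate_own: "own q \<noteq> 0 \<Longrightarrow> mate (own q) \<noteq> 0"
    and mate_0: "mate 0 = 0"
    and mate_less: "mate h \<noteq> 0 \<Longrightarrow> h < N"
    and mate_mate: "mate h \<noteq> 0 \<Longrightarrow> mate (mate h) = h"
    and own_mate: "mate h \<noteq> 0 \<Longrightarrow> own h = 0"
begin

definition head_of :: "nat \<Rightarrow> nat" where
  "head_of q = (if own q = 0 then q else own q)"

text \<open>The occurrences must differ, but their terms need not: this makes a term with a repeated
  variable conflict with itself.\<close>

definition conflict :: "nat \<Rightarrow> nat \<Rightarrow> bool" where
  "conflict a b \<longleftrightarrow> a \<noteq> 0 \<and> b \<noteq> 0 \<and> (\<exists>p q. p \<noteq> q \<and> own p = a \<and> own q = b \<and> val p = val q)"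

text \<open>Position 0 holds the number of clauses and is never an occurrence, so 0 can stand for
  the absence of a match.\<close>

fun last_match :: "nat \<Rightarrow> nat \<Rightarrow> nat" where
  "last_match i 0 = 0"
| "last_match i (Suc j) = (if own j \<noteq> 0 \<and> val j = val i then j else last_match i j)"

abbreviation prv :: "nat \<Rightarrow> nat" where
  "prv i \<equiv> last_match i i"

lemma last_match_matches:
  "last_match i n \<noteq> 0 \<Longrightarrow> last_match i n < n \<and> own (last_match i n) \<noteq> 0 \<and> val (last_match i n) = val i"
  by (induction n) (auto split: if_splits)

lemma last_match_ge: "own j \<noteq> 0 \<Longrightarrow> val j = val i \<Longrightarrow> j < n \<Longrightarrow> j \<le> last_match i n"
  by (induction n) (auto simp: less_Suc_eq split: if_splits)

text \<open>
  For positions \<open>q < N\<close>, the node \<open>q\<close> stands for the choice of the term at or around \<open>q\<close>, \<open>N + q\<close> for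
  the exclusion of the occurrence \<open>q\<close> and all later occurrences of its variable, \<open>2 * N + q\<close> for that
  of \<open>q\<close> and all earlier ones, and \<open>3 * N + q\<close> for the exclusion of the term \<open>q\<close>.
\<close>

inductive edge :: "nat \<Rightarrow> nat \<Rightarrow> bool" where
  next_cell: "own q \<noteq> 0 \<Longrightarrow> edge (q - 1) q"
| exclude_F: "own q \<noteq> 0 \<Longrightarrow> edge (N + q) (3 * N + own q)"
| exclude_B: "own q \<noteq> 0 \<Longrightarrow> edge (2 * N + q) (3 * N + own q)"
| choose_mate: "mate h \<noteq> 0 \<Longrightarrow> edge (3 * N + h) (mate h)"
| start_F: "own q \<noteq> 0 \<Longrightarrow> prv q \<noteq> 0 \<Longrightarrow> edge (prv q) (N + q)"
| step_F: "own q \<noteq> 0 \<Longrightarrow> prv q \<noteq> 0 \<Longrightarrow> edge (N + prv q) (N + q)"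
| start_B: "own q \<noteq> 0 \<Longrightarrow> prv q \<noteq> 0 \<Longrightarrow> edge q (2 * N + prv q)"
| step_B: "own q \<noteq> 0 \<Longrightarrow> prv q \<noteq> 0 \<Longrightarrow> edge (2 * N + q) (2 * N + prv q)"

lemma mate_nz: "mate h \<noteq> 0 \<Longrightarrow> h \<noteq> 0 \<and> mate (mate h) \<noteq> 0"
  using mate_0 mate_mate by metis

lemma owner_less: "own q \<noteq> 0 \<Longrightarrow> own q < N"
  using mate_own mate_less by blast

lemma conflict_nz: "conflict a b \<Longrightarrow> mate a \<noteq> 0 \<and> mate b \<noteq> 0"
  using mate_own by (auto simp: conflict_def)

lemma conflict_sym: "conflict a b \<Longrightarrow> conflict b a"
  unfolding conflict_def by metis

sublocale two_sat "{h. mate h \<noteq> 0}" mate conflict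
proof
  have "{h. mate h \<noteq> 0} \<subseteq> {..<N}" using mate_less by auto
  then show "finite {h. mate h \<noteq> 0}" by (rule finite_subset) simp
  show "mate h \<in> {h. mate h \<noteq> 0}" if "h \<in> {h. mate h \<noteq> 0}" for h
    using that mate_nz by blast
  show "mate (mate h) = h" if "h \<in> {h. mate h \<noteq> 0}" for h
    using that mate_mate by blast
  show "a \<in> {h. mate h \<noteq> 0}" if "conflict a b" for a b
    using that conflict_nz by blast
qed (rule conflict_sym)

section \<open>Completeness: conflicts and implications are followed by paths\<close>

lemma own_path: "own q \<noteq> 0 \<Longrightarrow> edge\<^sup>*\<^sup>* (own q) q"
proof (induction q)
  case 0
  then show ?case using own_less by blast
next
  case (Suc q)
  have e: "edge q (Suc q)" using next_cell[OF Suc.prems] by simp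
  show ?case
  proof (cases "own q = 0")
    case True
    then show ?thesis using own_pred[OF Suc.prems] e by auto
  next
    case False
    then show ?thesis using own_pred[OF Suc.prems] Suc.IH e by auto
  qed
qed

text \<open>Walk back from \<open>q\<close> along previous occurrences; none is skipped, so the walk
  arrives exactly at \<open>p\<close>, whose choice enters the chain at the next occurrence.\<close>

lemma F_path:
  assumes "own p \<noteq> 0" "own q \<noteq> 0" "p < q" "val p = val q"
  shows "edge\<^sup>*\<^sup>* p (N + q)"
  using assms
proof (induction q rule: less_induct)
  case (less q)
  have ge: "p \<le> prv q" using less.prems last_match_ge by simp
  then have nz: "prv q \<noteq> 0" using less.prems own_less[of p] by linarith
  note m = last_match_matches[OF nz]
  show ?case
  proof (cases "p = prv q")
    case True
    then show ?thesis using start_F[OF less.prems(2) nz] by auto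
  next
    case False
    then have "edge\<^sup>*\<^sup>* p (N + prv q)" using less ge m by simp
    then show ?thesis using step_F[OF less.prems(2) nz] by simp
  qed
qed

text \<open>This chain descends from \<open>p\<close>, and the induction moves its start. After the
  first step only chain nodes are met, so the path from \<open>2 * N + p\<close> has to be carried
  along with the one from \<open>p\<close>.\<close>

lemma B_path:
  assumes "own p \<noteq> 0" "own q \<noteq> 0" "q < p" "val p = val q"
  shows "edge\<^sup>*\<^sup>* (2 * N + p) (2 * N + q) \<and> edge\<^sup>*\<^sup>* p (2 * N + q)"
  using assms
proof (induction p rule: less_induct)
  case (less p)
  have ge: "q \<le> prv p" using less.prems last_match_ge by simp
  then have nz: "prv p \<noteq> 0" using less.prems own_less[of q] by linarith
  note m = last_match_matches[OF nz]
  have "edge\<^sup>*\<^sup>* (2 * N + prv p) (2 * N + q)"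
  proof (cases "q = prv p")
    case False
    then show ?thesis using less ge m by simp
  qed auto
  then show ?case
    using start_B[OF less.prems(1) nz] step_B[OF less.prems(1) nz]
    by (meson converse_rtranclp_into_rtranclp)
qed

lemma conflict_path:
  assumes "conflict a b"
  shows "edge\<^sup>*\<^sup>* a (3 * N + b)"
proof -
  obtain p q where pq: "own p = a" "own q = b" "p \<noteq> q" "val p = val q" "own p \<noteq> 0" "own q \<noteq> 0"
    using assms unfolding conflict_def by auto
  have "edge\<^sup>*\<^sup>* a p" using own_path pq by blast
  moreover have "edge\<^sup>*\<^sup>* p (3 * N + b)"
  proof (cases "p < q")
    case True
    then show ?thesis using F_path[of p q] exclude_F[of q] pq by auto
  next
    case False
    then show ?thesis using B_path[of p q] exclude_B[of q] pq by auto
  qed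
  ultimately show ?thesis by simp
qed

lemma implies_path: "(a, b) \<in> implies\<^sup>* \<Longrightarrow> edge\<^sup>*\<^sup>* a b"
proof (induction rule: rtrancl_induct)
  case (step b c)
  then obtain d where d: "c = mate d" "conflict b d" unfolding implies_def by auto
  have "edge (3 * N + d) c" using choose_mate conflict_nz d by simp
  with conflict_path[OF d(2)] step.IH show ?case by simp
qed simp

section \<open>Soundness: what reaching a node may mean\<close>

definition forced :: "nat \<Rightarrow> nat \<Rightarrow> bool" where
  "forced a x \<longleftrightarrow> x = 0 \<or>
     (x \<noteq> 0 \<and> x < N \<and> (a, head_of x) \<in> implies\<^sup>*) \<or>
     (\<exists>q p. x = N + q \<and> q < N \<and> own q \<noteq> 0 \<and> own p \<noteq> 0 \<and> p < q \<and> val p = val q \<and> (a, own p) \<in> implies\<^sup>*) \<or>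
     (\<exists>q p. x = 2 * N + q \<and> q < N \<and> own q \<noteq> 0 \<and> own p \<noteq> 0 \<and> q < p \<and> val p = val q \<and> (a, own p) \<in> implies\<^sup>*) \<or>
     (\<exists>h c. x = 3 * N + h \<and> h < N \<and> h \<noteq> 0 \<and> (a, c) \<in> implies\<^sup>* \<and> conflict c h)"

lemma forced_C: "q < N \<Longrightarrow> forced a q \<longleftrightarrow> q = 0 \<or> (a, head_of q) \<in> implies\<^sup>*"
  unfolding forced_def by auto

lemma forced_F: "q < N \<Longrightarrow> forced a (N + q) \<longleftrightarrow> own q \<noteq> 0 \<and>
    (\<exists>p. own p \<noteq> 0 \<and> p < q \<and> val p = val q \<and> (a, own p) \<in> implies\<^sup>*)"
  unfolding forced_def by auto

lemma forced_B: "q < N \<Longrightarrow> forced a (2 * N + q) \<longleftrightarrow> own q \<noteq> 0 \<and>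
    (\<exists>p. own p \<noteq> 0 \<and> q < p \<and> val p = val q \<and> (a, own p) \<in> implies\<^sup>*)"
  unfolding forced_def by auto

lemma forced_X: "h < N \<Longrightarrow> forced a (3 * N + h) \<longleftrightarrow> (\<exists>c. (a, c) \<in> implies\<^sup>* \<and> conflict c h)"
  unfolding forced_def by (auto simp: conflict_def)

text \<open>A chain node is witnessed by an implied occurrence strictly before it (for
  \<open>N + q\<close>) or strictly after it (for \<open>2 * N + q\<close>). Walking on along the
  chain keeps the witness, and leaving the chain turns it into a conflict.\<close>

lemma forced_edge:
  assumes "edge x y" and "forced a x"
  shows "forced a y"
  using assms
proof (cases rule: edge.cases)
  case (next_cell)
  have q: "0 < y" "y < N" using own_less[of y] next_cell by auto
  have t: "head_of (y - 1) = own y" using own_pred[of y] next_cell by (auto simp: head_of_def)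
  \<comment> \<open>Node 0 counts as forced by default, so nothing could be inferred from an edge
    that starts there.\<close>
  have "y - 1 \<noteq> 0"
  proof
    assume "y - 1 = 0"
    then have "own (y - 1) \<noteq> 0" using t next_cell by (auto simp: head_of_def split: if_splits)
    then show False using \<open>y - 1 = 0\<close> own_less[of 0] by simp
  qed
  then have "(a, own y) \<in> implies\<^sup>*"
    using assms(2) next_cell q t forced_C[of "y - 1" a] by simp
  then show ?thesis using q next_cell forced_C[of y a] by (simp add: head_of_def)
next
  case (exclude_F q)
  obtain p where "p < q" "own p \<noteq> 0" "val p = val q" "(a, own p) \<in> implies\<^sup>*"
    using assms(2) exclude_F forced_F[of q a] own_less[of q] by auto
  moreover from this have "conflict (own p) (own q)"
    using exclude_F unfolding conflict_def by (metis less_irrefl)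
  ultimately show ?thesis using exclude_F forced_X[OF owner_less[of q]] by blast
next
  case (exclude_B q)
  obtain p where "q < p" "own p \<noteq> 0" "val p = val q" "(a, own p) \<in> implies\<^sup>*"
    using assms(2) exclude_B forced_B[of q a] own_less[of q] by auto
  moreover from this have "conflict (own p) (own q)"
    using exclude_B unfolding conflict_def by (metis less_irrefl)
  ultimately show ?thesis using exclude_B forced_X[OF owner_less[of q]] by blast
next
  case (choose_mate h)
  have m: "h < N" "mate h < N" "own (mate h) = 0"
    using mate_less[of h] mate_nz[of h] mate_less[of "mate h"] own_mate[of "mate h"] choose_mate by auto
  obtain c where c: "(a, c) \<in> implies\<^sup>*" "conflict c h"
    using assms(2) choose_mate forced_X[OF m(1)] by auto
  then have "(c, mate h) \<in> implies" unfolding implies_def by blast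
  with c have "(a, mate h) \<in> implies\<^sup>*" by (simp add: rtrancl_into_rtrancl)
  then show ?thesis using choose_mate m forced_C[of "mate h" a] by (simp add: head_of_def)
next
  case (start_F q)
  note m = last_match_matches[OF start_F(4)] and N = own_less[OF start_F(3)]
  then have "(a, own (prv q)) \<in> implies\<^sup>*"
    using assms(2) start_F forced_C[of "prv q" a] by (simp add: head_of_def)
  then show ?thesis using m N start_F forced_F[of q a] by blast
next
  case (step_F q)
  note m = last_match_matches[OF step_F(4)] and N = own_less[OF step_F(3)]
  then obtain p where "own p \<noteq> 0" "p < prv q" "val p = val q" "(a, own p) \<in> implies\<^sup>*"
    using assms(2) step_F forced_F[of "prv q" a] by auto
  moreover from this m have "p < q" by linarith
  ultimately show ?thesis using N step_F forced_F[of q a] by blast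
next
  case (start_B)
  note m = last_match_matches[OF start_B(3)] and N = own_less[OF start_B(2)]
  then have "(a, own x) \<in> implies\<^sup>*"
    using assms(2) start_B forced_C[of x a] by (simp add: head_of_def)
  then show ?thesis using m N start_B forced_B[of "prv x" a] by auto
next
  case (step_B q)
  note m = last_match_matches[OF step_B(4)] and N = own_less[OF step_B(3)]
  then obtain p where "own p \<noteq> 0" "q < p" "val p = val q" "(a, own p) \<in> implies\<^sup>*"
    using assms(2) step_B forced_B[of q a] by auto
  moreover from this m have "prv q < p" by linarith
  ultimately show ?thesis using m N step_B forced_B[of "prv q" a] by auto
qed

text \<open>Each kind of edge into this block comes from an occurrence or from a term. Hence a path
  into an exclusion node certifies a genuine term.\<close>

lemma edge_to_X:
  assumes "edge x (3 * N + v)"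
  shows "mate v \<noteq> 0"
proof -
  from assms show ?thesis
  proof (cases rule: edge.cases)
    case next_cell
    then show ?thesis using own_less[of "3 * N + v"] by simp
  next
    case (exclude_F q)
    then show ?thesis using mate_own by auto
  next
    case (exclude_B q)
    then show ?thesis using mate_own by auto
  next
    case (choose_mate h)
    then show ?thesis using mate_less[of "mate h"] mate_nz[of h] by auto
  next
    case (start_F q)
    then show ?thesis using own_less[of q] by auto
  next
    case (step_F q)
    then show ?thesis using own_less[of q] by auto
  next
    case start_B
    then show ?thesis using own_less[of x] last_match_matches[of x x] by auto
  next
    case (step_B q)
    then show ?thesis using own_less[of q] last_match_matches[of q q] by auto
  qed
qed

lemma edge_less: "edge x y \<Longrightarrow> y < 4 * N"
proof (induction rule: edge.induct)
  case (next_cell q)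
  then show ?case using own_less[of q] by simp
next
  case (exclude_F q)
  then show ?case using owner_less[of q] by simp
next
  case (exclude_B q)
  then show ?case using owner_less[of q] by simp
next
  case (choose_mate h)
  then show ?case using mate_less[of "mate h"] mate_nz[of h] by simp
next
  case (start_F q)
  then show ?case using own_less[of q] by simp
next
  case (step_F q)
  then show ?case using own_less[of q] by simp
next
  case (start_B q)
  then show ?case using own_less[of q] last_match_matches[of q q] by simp
next
  case (step_B q)
  then show ?case using own_less[of q] last_match_matches[of q q] by simp
qed

text \<open>
  \<open>G\<close> may have additional edges to the node \<open>0\<close>, because a missing successor is stored as \<open>0\<close>.
\<close>

theorem unsolvable_iff_paths:
  assumes "0 < N"
    and "\<And>x y. edge x y \<Longrightarrow> G x y" and "\<And>x y. G x y \<Longrightarrow> edge x y \<or> y = 0"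
  shows "\<not> (\<exists>S. solution S) \<longleftrightarrow> (\<exists>v<N. G\<^sup>*\<^sup>* v (3 * N + v) \<and> G\<^sup>*\<^sup>* (mate v) (3 * N + mate v))"
proof -
  have "edge \<le> G" using assms(2) by (intro predicate2I)
  then have mono: "edge\<^sup>*\<^sup>* \<le> G\<^sup>*\<^sup>*" by (rule rtranclp_mono)
  have complete: "G\<^sup>*\<^sup>* h (3 * N + h)" if b: "bad h" for h
  proof -
    obtain c where "(h, c) \<in> implies\<^sup>*" "conflict c h" using b unfolding bad_def by blast
    from rtranclp_trans[OF implies_path[OF this(1)] conflict_path[OF this(2)]]
    show ?thesis by (rule predicate2D[OF mono])
  qed
  have fG: "forced a y" if "G\<^sup>*\<^sup>* x y" "forced a x" for a x y
    using that
  proof (induction rule: rtranclp_induct)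
    case (step y z)
    then show ?case using assms(3)[OF step.hyps(2)] forced_edge[of y z a] forced_C[OF assms(1), of a] by blast
  qed
  have sound: "bad h" if "G\<^sup>*\<^sup>* h (3 * N + h)" "mate h \<noteq> 0" for h
  proof -
    have "h < N" "own h = 0" using that mate_less[of h] own_mate[of h] by auto
    then have "forced h h" by (simp add: forced_C head_of_def)
    then show ?thesis using fG[OF that(1)] \<open>h < N\<close> by (simp add: forced_X bad_def)
  qed
  have mate: "mate v \<noteq> 0" if "G\<^sup>*\<^sup>* v (3 * N + v)" for v
  proof -
    \<comment> \<open>The path is not empty because \<open>0 < N\<close>, so it has a last edge,
      which shows that \<open>v\<close> is a term.\<close>
    have "\<exists>x. G x (3 * N + v)"
      using that by (cases rule: rtranclp.cases) (use assms(1) in auto)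
    then obtain x where "G x (3 * N + v)" ..
    then show ?thesis using assms(1) assms(3)[of x "3 * N + v"] edge_to_X[of x v] by linarith
  qed
  show ?thesis
  proof
    assume "\<not> (\<exists>S. solution S)"
    then obtain h where "mate h \<noteq> 0" "bad h" "bad (mate h)" using solvable_iff by auto
    then show "\<exists>v<N. G\<^sup>*\<^sup>* v (3 * N + v) \<and> G\<^sup>*\<^sup>* (mate v) (3 * N + mate v)"
      using complete[of h] complete[of "mate h"] mate_less[of h] by blast
  next
    assume "\<exists>v<N. G\<^sup>*\<^sup>* v (3 * N + v) \<and> G\<^sup>*\<^sup>* (mate v) (3 * N + mate v)"
    then obtain v where v: "G\<^sup>*\<^sup>* v (3 * N + v)" "G\<^sup>*\<^sup>* (mate v) (3 * N + mate v)" by blast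
    have "mate v \<noteq> 0" "mate (mate v) \<noteq> 0" using mate[OF v(1)] mate_nz[of v] by auto
    then have "bad v" "bad (mate v)" using sound v by auto
    then show "\<not> (\<exists>S. solution S)" using solvable_iff mate[OF v(1)] by auto
  qed
qed

end

section \<open>Encoded polynomials\<close>

definition cells :: "nat list \<Rightarrow> nat \<Rightarrow> nat set" where
  "cells xs h = {h<..h + xs ! h}"

definition content :: "nat list \<Rightarrow> nat \<Rightarrow> pterm" where
  "content xs h = map ((!) xs) [Suc h..<Suc h + xs ! h]"

text \<open>Parser and graph use absolute addresses, so encodings are located inside the whole word
  instead of being cut out of it.\<close>

definition reads :: "nat list \<Rightarrow> nat \<Rightarrow> nat list \<Rightarrow> bool" where
  "reads xs i ys \<longleftrightarrow> (\<forall>j<length ys. xs ! (i + j) = ys ! j)"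

lemma reads_Nil [simp]: "reads xs i []"
  by (simp add: reads_def)

lemma reads_Cons [simp]: "reads xs i (y # ys) \<longleftrightarrow> xs ! i = y \<and> reads xs (Suc i) ys"
  by (simp add: reads_def All_less_Suc2)

lemma reads_append [simp]: "reads xs i (ys @ zs) \<longleftrightarrow> reads xs i ys \<and> reads xs (i + length ys) zs"
  by (induction ys arbitrary: i) auto

lemma reads_map: "reads xs i ys \<Longrightarrow> map ((!) xs) [i..<i + length ys] = ys"
  by (rule nth_equalityI) (auto simp: reads_def)

fun heads :: "nat \<Rightarrow> clause \<Rightarrow> nat list" where
  "heads i [] = []"
| "heads i (T # f) = i # heads (i + length (encode_term T)) f"

fun clause_heads :: "nat \<Rightarrow> psp \<Rightarrow> nat list list" where
  "clause_heads i [] = []"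
| "clause_heads i (f # p) = heads (Suc i) f # clause_heads (i + length (encode_clause f)) p"

lemma content_encode_term: "reads xs i (encode_term T) \<Longrightarrow> content xs i = T"
  using reads_map[of xs "Suc i" T] by (simp add: content_def encode_term_def)

lemma content_heads:
  "reads xs i (concat (map encode_term f)) \<Longrightarrow> map (content xs) (heads i f) = f"
  by (induction f arbitrary: i) (auto simp: content_encode_term)

lemma content_clause_heads:
  "reads xs i (concat (map encode_clause p)) \<Longrightarrow> map (map (content xs)) (clause_heads i p) = p"
  by (induction p arbitrary: i) (auto simp: content_heads encode_clause_def)

lemma heads_bounds:
  "reads xs i (concat (map encode_term f)) \<Longrightarrow> h \<in> set (heads i f) \<Longrightarrow>
   i \<le> h \<and> h + xs ! h < i + length (concat (map encode_term f))"
  by (induction f arbitrary: i) (fastforce simp: encode_term_def)+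

lemma clause_heads_bounds:
  "reads xs i (concat (map encode_clause p)) \<Longrightarrow> l \<in> set (clause_heads i p) \<Longrightarrow> h \<in> set l \<Longrightarrow>
   i < h \<and> h + xs ! h < i + length (concat (map encode_clause p))"
proof (induction p arbitrary: i)
  case (Cons f p)
  show ?case
  proof (cases "l = heads (Suc i) f")
    case True
    then show ?thesis
      using Cons.prems heads_bounds[of xs "Suc i" f h] by (auto simp: encode_clause_def)
  next
    case False
    then show ?thesis
      using Cons.prems Cons.IH[of "i + length (encode_clause f)"] by auto
  qed
qed simp

text \<open>The relation skips the entire term at \<open>h\<close>; it yields at once distinct
  heads, disjoint cells, and that no head lies in a cell.\<close>

lemma sorted_heads:
  "reads xs i (concat (map encode_term f)) \<Longrightarrow> sorted_wrt (\<lambda>h k. h + xs ! h < k) (heads i f)"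
proof (induction f arbitrary: i)
  case (Cons T f)
  have "reads xs i (encode_term T)" and T: "reads xs (i + length (encode_term T)) (concat (map encode_term f))"
    using Cons.prems by simp_all
  then have x: "xs ! i = length T" by (simp add: encode_term_def)
  have "i + xs ! i < k" if "k \<in> set (heads (i + length (encode_term T)) f)" for k
    using heads_bounds[OF T that] x by (simp add: encode_term_def)
  then show ?case using Cons.IH[OF T] by simp
qed simp

lemma sorted_clause_heads:
  "reads xs i (concat (map encode_clause p)) \<Longrightarrow>
   sorted_wrt (\<lambda>h k. h + xs ! h < k) (concat (clause_heads i p))"
proof (induction p arbitrary: i)
  case (Cons f p)
  have c: "reads xs i (encode_clause f)" "reads xs (i + length (encode_clause f)) (concat (map encode_clause p))"
    using Cons.prems by simp_all
  note r = c(1)[unfolded encode_clause_def reads_Cons, THEN conjunct2] c(2)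
  have l: "length (encode_clause f) = Suc (length (concat (map encode_term f)))"
    by (simp add: encode_clause_def)
  have "h + xs ! h < k"
    if "h \<in> set (heads (Suc i) f)" "l \<in> set (clause_heads (i + length (encode_clause f)) p)" "k \<in> set l" for h l k
    using heads_bounds[OF r(1) that(1)] clause_heads_bounds[OF r(2) that(2,3)] l by simp
  then show ?case
    using Cons.IH[OF r(2)] sorted_heads[OF r(1)] by (auto simp: sorted_wrt_append)
qed simp

section \<open>Multilinearity in terms of positions\<close>

lemma multilinear_mset: "multilinear (mset ys) \<longleftrightarrow> distinct ys"
  unfolding multilinear_def distinct_count_atmost_1
  by (metis count_eq_zero_iff set_mset_mset)

lemma product_lists_map: "product_lists (map (map g) L) = map (map g) (product_lists L)"
  by (induction L) (auto simp: map_concat comp_def)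

lemma set_choice:
  "hs \<in> set (product_lists L) \<longleftrightarrow> list_all2 (\<lambda>h l. h \<in> set l) hs L"
  by (simp add: product_lists_set)

lemma sorted_choice:
  "list_all2 (\<lambda>h l. h \<in> set l) hs L \<Longrightarrow> sorted_wrt R (concat L) \<Longrightarrow> sorted_wrt R hs"
proof (induction rule: list_all2_induct)
  case (Cons h hs l L)
  have "\<exists>l\<in>set L. k \<in> set l" if "k \<in> set hs" for k
    using Cons.hyps(2) that by (metis in_set_conv_nth list_all2_conv_all_nth)
  then show ?case using Cons by (auto simp: sorted_wrt_append)
qed simp

text \<open>The chosen terms list the entries of the word at pairwise disjoint cells, so an exponent
  above 1 amounts to a repeated entry on their union, be it within one term or across two.\<close>

lemma multilinear_choice:
  assumes "sorted_wrt (\<lambda>h k. h + xs ! h < k) hs"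
  shows "multilinear (\<Sum>T\<leftarrow>map (content xs) hs. mset T) \<longleftrightarrow> inj_on ((!) xs) (\<Union>h\<in>set hs. cells xs h)"
proof -
  let ?zs = "concat (map (\<lambda>h. [Suc h..<Suc h + xs ! h]) hs)"
  have "(\<Sum>T\<leftarrow>map (content xs) hs. mset T) = mset (map ((!) xs) ?zs)"
    by (induction hs) (auto simp: content_def)
  moreover have "distinct ?zs"
    using assms
  proof (induction hs)
    case (Cons h hs)
    then show ?case by (force simp del: upt.simps)
  qed simp
  moreover have "set ?zs = (\<Union>h\<in>set hs. cells xs h)"
    by (auto simp: cells_def)
  ultimately show ?thesis by (simp only: multilinear_mset distinct_map simp_thms)
qed

lemma has_multilinear_monomial_iff:
  assumes "reads xs i (concat (map encode_clause p))"
  shows "has_multilinear_monomial p \<longleftrightarrow>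
    (\<exists>hs. list_all2 (\<lambda>h l. h \<in> set l) hs (clause_heads i p) \<and>
          inj_on ((!) xs) (\<Union>h\<in>set hs. cells xs h))"
proof -
  let ?L = "clause_heads i p"
  have "expansion p = map (\<lambda>hs. \<Sum>T\<leftarrow>map (content xs) hs. mset T) (product_lists ?L)"
    unfolding expansion_def
    by (subst content_clause_heads[OF assms, symmetric]) (simp add: product_lists_map comp_def)
  then have "has_multilinear_monomial p \<longleftrightarrow>
      (\<exists>hs. list_all2 (\<lambda>h l. h \<in> set l) hs ?L \<and> multilinear (\<Sum>T\<leftarrow>map (content xs) hs. mset T))"
    unfolding has_multilinear_monomial_def by (auto simp: set_choice)
  then show ?thesis
    using multilinear_choice[OF sorted_choice[OF _ sorted_clause_heads[OF assms]]] by auto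
qed

text \<open>
  The components are \<open>own\<close>, \<open>mate\<close>, the numbers of variables left in the current term and of terms
  left in the current clause, the current term, the first term of the current clause, and whether no
  empty clause has been seen.
\<close>

type_synonym parse_state = "(nat \<Rightarrow> nat) \<times> (nat \<Rightarrow> nat) \<times> nat \<times> nat \<times> nat \<times> nat \<times> bool"

fun parse_step :: "nat list \<Rightarrow> nat \<Rightarrow> parse_state \<Rightarrow> parse_state" where
  "parse_step xs i (own, mate, t, c, h, g, ok) =
     (if 0 < t then (own(i := h), mate, t - 1, c, h, g, ok)
      else if 0 < c then (own, mate(i := g, g := i), xs ! i, c - 1, i, g, ok)
      else (own, mate, 0, xs ! i, h, i + 1, ok \<and> xs ! i \<noteq> 0))"

lemma upt_add_Suc: "[i..<i + Suc n] = i # [Suc i..<Suc i + n]"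
  by (subst upt_conv_Cons) simp_all

lemma fold_parse_cells:
  "fold (parse_step xs) [i..<i + n] (own, mate, n, c, h, g, ok) =
   (\<lambda>q. if i \<le> q \<and> q < i + n then h else own q, mate, 0, c, h, g, ok)"
proof (induction n arbitrary: i own)
  case (Suc n)
  have "fold (parse_step xs) [i..<i + Suc n] (own, mate, Suc n, c, h, g, ok) =
      fold (parse_step xs) [Suc i..<Suc i + n] (own(i := h), mate, n, c, h, g, ok)"
    by (simp only: upt_add_Suc fold_simps) simp
  also have "\<dots> = (\<lambda>q. if Suc i \<le> q \<and> q < Suc i + n then h else (own(i := h)) q, mate, 0, c, h, g, ok)"
    by (rule Suc)
  also have "\<dots> = (\<lambda>q. if i \<le> q \<and> q < i + Suc n then h else own q, mate, 0, c, h, g, ok)"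
    by (auto simp: fun_eq_iff)
  finally show ?case .
qed (simp add: fun_eq_iff)

definition claim :: "nat list \<Rightarrow> nat \<Rightarrow> (nat \<Rightarrow> nat) \<Rightarrow> nat \<Rightarrow> nat" where
  "claim xs h own q = (if q \<in> cells xs h then h else own q)"

lemma fold_parse_term:
  assumes "reads xs i (encode_term T)"
  shows "fold (parse_step xs) [i..<i + length (encode_term T)] (own, mate, 0, Suc c, h, g, ok) =
    (claim xs i own, mate(i := g, g := i), 0, c, i, g, ok)"
proof -
  have x: "xs ! i = length T" using assms by (simp add: encode_term_def)
  have seg: "[i..<i + length (encode_term T)] = i # [Suc i..<Suc i + length T]"
    using upt_add_Suc[of i "length T"] by (simp only: encode_term_def length_Cons)
  have "fold (parse_step xs) [i..<i + length (encode_term T)] (own, mate, 0, Suc c, h, g, ok) =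
      fold (parse_step xs) [Suc i..<Suc i + length T] (own, mate(i := g, g := i), length T, c, i, g, ok)"
    by (simp only: seg fold_simps) (simp add: x)
  also have "\<dots> = (claim xs i own, mate(i := g, g := i), 0, c, i, g, ok)"
    by (simp only: fold_parse_cells) (auto simp: fun_eq_iff cells_def claim_def x)
  finally show ?thesis .
qed

text \<open>In a clause of one or two terms, \<open>hd\<close> and \<open>last\<close> are all the
  terms, and they coincide if there is only one.\<close>

definition pair_up :: "'a list \<Rightarrow> ('a \<Rightarrow> 'a) \<Rightarrow> 'a \<Rightarrow> 'a" where
  "pair_up l m = (if l = [] then m else m(hd l := last l, last l := hd l))"

text \<open>Both counters return to 0, so the next cell is again read as a clause length. The bound
  2 enters because a third term would be paired with the first one once more.\<close>

lemma fold_parse_clause: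
  assumes "reads xs i (encode_clause f)" and "length f \<le> 2"
  shows "\<exists>h' g'. fold (parse_step xs) [i..<i + length (encode_clause f)] (own, mate, 0, 0, h, g, ok) =
    (fold (claim xs) (heads (Suc i) f) own,
     pair_up (heads (Suc i) f) mate, 0, 0, h', g', ok \<and> f \<noteq> [])"
proof -
  have seg: "[i..<i + length (encode_clause f)] = i # [Suc i..<Suc i + length (concat (map encode_term f))]"
    using upt_add_Suc[of i "length (concat (map encode_term f))"] by (simp only: encode_clause_def length_Cons)
  have x: "xs ! i = length f" "reads xs (Suc i) (concat (map encode_term f))"
    using assms(1) by (auto simp: encode_clause_def)
  consider "f = []" | T where "f = [T]" | T U where "f = [T, U]"
    using assms(2) by (cases f; cases "tl f"; cases "tl (tl f)") auto
  then show ?thesis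
  proof cases
    case 1
    then show ?thesis using seg x by (simp add: pair_up_def)
  next
    case 2
    then show ?thesis using seg x by (simp add: fold_parse_term[of xs "Suc i" T, unfolded add_Suc] pair_up_def del: upt.simps)
  next
    case 3
    let ?b = "Suc i + length (encode_term T)"
    have "[Suc i..<Suc i + length (concat (map encode_term f))] =
        [Suc i..<Suc i + length (encode_term T)] @ [?b..<?b + length (encode_term U)]"
      using 3 upt_add_eq_append[of "Suc i" ?b "length (encode_term U)"]
      by (simp add: add.assoc del: upt.simps)
    moreover have "reads xs (Suc i) (encode_term T)" "reads xs ?b (encode_term U)"
      using x 3 by auto
    moreover have "?b \<noteq> Suc i" by (simp add: encode_term_def)
    ultimately show ?thesis using x(1) 3 seg
      by (simp add: fold_parse_term[of xs "Suc i" T, unfolded add_Suc]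
          fold_parse_term[of xs "Suc (i + length (encode_term T))" U, unfolded add_Suc]
          pair_up_def numeral_2_eq_2 del: upt.simps) (auto simp: fun_eq_iff)
  qed
qed

lemma fold_parse:
  assumes "reads xs i (concat (map encode_clause p))" and "\<forall>f\<in>set p. length f \<le> 2"
  shows "\<exists>h' g'. fold (parse_step xs) [i..<i + length (concat (map encode_clause p))] (own, mate, 0, 0, h, g, ok) =
    (fold (claim xs) (concat (clause_heads i p)) own,
     fold pair_up (clause_heads i p) mate, 0, 0, h', g', ok \<and> [] \<notin> set p)"
  using assms
proof (induction p arbitrary: i own mate h g ok)
  case (Cons f p)
  let ?j = "i + length (encode_clause f)"
  have upt: "[i..<i + length (concat (map encode_clause (f # p)))] =
      [i..<?j] @ [?j..<?j + length (concat (map encode_clause p))]"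
    using upt_add_eq_append[of i ?j "length (concat (map encode_clause p))"] by (simp add: add.assoc)
  have r: "reads xs i (encode_clause f)" "reads xs ?j (concat (map encode_clause p))"
    using Cons.prems by simp_all
  obtain h' g' where 1: "fold (parse_step xs) [i..<?j] (own, mate, 0, 0, h, g, ok) =
      (fold (claim xs) (heads (Suc i) f) own, pair_up (heads (Suc i) f) mate, 0, 0, h', g', ok \<and> f \<noteq> [])"
    using fold_parse_clause[OF r(1)] Cons.prems(2) by (metis list.set_intros(1))
  show ?case
    using Cons.IH[OF r(2), of "fold (claim xs) (heads (Suc i) f) own" "pair_up (heads (Suc i) f) mate" h' g' "ok \<and> f \<noteq> []"]
      Cons.prems(2)
    by (auto simp only: upt fold_append comp_apply 1 clause_heads.simps concat.simps fold_simps
        list.set ball_simps insert_iff de_Morgan_disj conj_assoc eq_commute[of "[]" f])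
qed auto

lemma fold_claim_other: "\<forall>h\<in>set hs. q \<notin> cells xs h \<Longrightarrow> fold (claim xs) hs own q = own q"
  by (induction hs arbitrary: own) (auto simp: claim_def)

text \<open>Disjoint cells: no later claim overwrites an earlier one.\<close>

lemma fold_claim:
  assumes "sorted_wrt (\<lambda>h k. h + xs ! h < k) hs" and "h \<in> set hs" and "q \<in> cells xs h"
  shows "fold (claim xs) hs own q = h"
  using assms
proof (induction hs arbitrary: own)
  case (Cons k hs)
  show ?case
  proof (cases "h = k")
    case True
    then have "\<forall>k\<in>set hs. q \<notin> cells xs k"
      using Cons.prems by (fastforce simp: cells_def)
    then show ?thesis using True Cons.prems by (simp add: fold_claim_other) (simp add: claim_def)
  next
    case False
    then show ?thesis using Cons by simp
  qed
qed simp

lemma fold_pair_up_other: "k \<notin> set (concat L) \<Longrightarrow> fold pair_up L m k = m k"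
proof (induction L arbitrary: m)
  case (Cons l L)
  have "pair_up l m k = m k"
    using Cons.prems hd_in_set[of l] last_in_set[of l] by (auto simp: pair_up_def)
  then show ?case using Cons by simp
qed simp

lemma fold_pair_up:
  assumes "distinct (concat L)" and "l \<in> set L" and "l \<noteq> []"
  shows "fold pair_up L m (hd l) = last l \<and> fold pair_up L m (last l) = hd l"
  using assms
proof (induction L arbitrary: m)
  case (Cons k L)
  show ?case
  proof (cases "l = k")
    case True
    have "hd l \<in> set l" "last l \<in> set l" using Cons.prems(3) by auto
    then have "hd l \<notin> set (concat L)" "last l \<notin> set (concat L)" using Cons.prems(1) True by auto
    then show ?thesis using True Cons.prems(3) by (simp add: fold_pair_up_other) (simp add: pair_up_def)
  next
    case False
    then show ?thesis using Cons by simp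
  qed
qed simp

text \<open>Position 0 holds the number of clauses, so reading starts behind it, at the first clause
  length.\<close>

definition parsed :: "nat list \<Rightarrow> parse_state" where
  "parsed xs = fold (parse_step xs) [1..<length xs] (\<lambda>_. 0, \<lambda>_. 0, 0, 0, 0, 0, True)"

lemma length_heads [simp]: "length (heads i f) = length f"
  by (induction f arbitrary: i) auto

lemma length_clause_heads: "l \<in> set (clause_heads i p) \<Longrightarrow> \<exists>f\<in>set p. length l = length f"
  by (induction p arbitrary: i) auto

lemma Nil_in_clause_heads: "[] \<in> set (clause_heads i p) \<longleftrightarrow> [] \<in> set p"
proof (induction p arbitrary: i)
  case (Cons f p)
  have "heads (Suc i) f = [] \<longleftrightarrow> f = []" by (cases f) auto
  then show ?case using Cons by auto
qed simp

text \<open>A choice of heads whose cells carry distinct entries is itself a solution; a solution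
  becomes a choice by keeping one of its terms per clause. The flag accounts for empty clauses,
  which \<open>mate\<close> cannot show.\<close>

lemma parsed_correct:
  assumes short: "\<forall>f\<in>set p. length f \<le> 2" and xs: "xs = encode p"
    and parsed: "parsed xs = (own, mate, t, c, h, g, ok)"
  shows "layout (length xs) own mate"
    and "ok \<longleftrightarrow> [] \<notin> set p"
    and "has_multilinear_monomial p \<longleftrightarrow>
      ok \<and> (\<exists>S. two_sat.solution {h. mate h \<noteq> 0} mate (layout.conflict ((!) xs) own) S)"
proof -
  let ?L = "clause_heads 1 p" and ?R = "\<lambda>h k. h + xs ! h < k"
  have len: "length xs = 1 + length (concat (map encode_clause p))"
    by (simp add: xs encode_def)
  have reads: "reads xs 1 (concat (map encode_clause p))"
    by (simp add: xs encode_def reads_def)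
  have own: "own = fold (claim xs) (concat ?L) (\<lambda>_. 0)" and mate: "mate = fold pair_up ?L (\<lambda>_. 0)"
    and ok: "ok \<longleftrightarrow> [] \<notin> set p"
    using fold_parse[OF reads short, of "\<lambda>_. 0" "\<lambda>_. 0" 0 0 True] parsed
    by (auto simp: parsed_def len)
  show "ok \<longleftrightarrow> [] \<notin> set p" by (rule ok)
  have sorted: "sorted_wrt ?R (concat ?L)"
    using sorted_clause_heads[OF reads] .
  have distinct: "distinct (concat ?L)"
    using sorted_wrt_mono_rel[OF _ sorted, of "(<)"] strict_sorted_iff by auto
  have bounds: "0 < h \<and> h + xs ! h < length xs" if "h \<in> set (concat ?L)" for h
  proof -
    obtain l where "l \<in> set ?L" "h \<in> set l" using \<open>h \<in> _\<close> by auto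
    then show ?thesis using clause_heads_bounds[OF reads] len by fastforce
  qed
  have own_cell: "own q = h" if "h \<in> set (concat ?L)" "q \<in> cells xs h" for h q
    unfolding own by (rule fold_claim[OF sorted that])
  have own_0: "own q = 0" if "\<forall>h\<in>set (concat ?L). q \<notin> cells xs h" for q
    unfolding own using fold_claim_other[OF that] .
  have owner: "own q \<in> set (concat ?L) \<and> q \<in> cells xs (own q)" if "own q \<noteq> 0" for q
  proof -
    obtain h where "h \<in> set (concat ?L)" "q \<in> cells xs h" using own_0[of q] \<open>own q \<noteq> 0\<close> by blast
    then show ?thesis using own_cell[of h q] by (simp only: simp_thms)
  qed
  \<comment> \<open>Two heads are equal or separated by the whole term of the smaller one.\<close>
  have own_head: "own h = 0" if "h \<in> set (concat ?L)" for h
  proof (rule own_0, rule ballI)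
    fix k assume "k \<in> set (concat ?L)"
    then obtain i j where ij: "i < length (concat ?L)" "concat ?L ! i = h" "j < length (concat ?L)" "concat ?L ! j = k"
      using \<open>h \<in> _\<close> \<open>k \<in> _\<close> unfolding in_set_conv_nth by blast
    consider "i < j" | "i = j" | "j < i" by linarith
    then have "h = k \<or> ?R h k \<or> ?R k h"
      by cases (use ij sorted_wrt_nth_less[OF sorted, of i j] sorted_wrt_nth_less[OF sorted, of j i] in auto)
    then show "h \<notin> cells xs k" by (auto simp: cells_def)
  qed
  have hd_or_last: "h = hd l \<or> h = last l" if l: "l \<in> set ?L" "h \<in> set l" for h l
  proof -
    have "length l \<le> 2" using length_clause_heads[OF l(1)] short by auto
    then show ?thesis using l(2) by (cases l; cases "tl l") auto
  qed
  have mate_L: "mate (hd l) = last l" "mate (last l) = hd l" if "l \<in> set ?L" "l \<noteq> []" for l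
    using fold_pair_up[OF distinct that] mate by auto
  have mate_out: "mate h = 0" if "h \<notin> set (concat ?L)" for h
    using fold_pair_up_other[OF that] mate by simp
  have mem: "\<exists>l\<in>set ?L. l \<noteq> [] \<and> (h = hd l \<and> mate h = last l \<or> h = last l \<and> mate h = hd l) \<and> hd l \<in> set l \<and> last l \<in> set l"
    if "h \<in> set (concat ?L)" for h
  proof -
    obtain l where l: "l \<in> set ?L" "h \<in> set l" using \<open>h \<in> _\<close> by auto
    then have ne: "l \<noteq> []" by auto
    show ?thesis
      using hd_or_last[OF l] mate_L[OF l(1) ne] l(1) ne by (intro bexI[of _ l]) auto
  qed
  have mate_iff: "mate h \<noteq> 0 \<longleftrightarrow> h \<in> set (concat ?L)" for h
  proof
    assume "h \<in> set (concat ?L)"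
    from mem[OF this] obtain l where l: "l \<in> set ?L" "mate h \<in> set l" by metis
    have "mate h \<in> set (concat ?L)" unfolding set_concat using l by blast
    then show "mate h \<noteq> 0" using bounds[of "mate h"] by linarith
  next
    assume "mate h \<noteq> 0"
    then show "h \<in> set (concat ?L)" by (rule contrapos_np) (rule mate_out)
  qed
  show L: "layout (length xs) own mate"
  proof
    fix q assume q: "own q \<noteq> 0"
    note o = owner[OF q]
    show "0 < q \<and> q < length xs"
      using bounds[of "own q"] o by (simp add: cells_def)
    show "(if own (q - 1) = 0 then q - 1 else own (q - 1)) = own q"
    proof (cases "q - 1 = own q")
      case True
      have "own (own q) = 0" using own_head o by blast
      then show ?thesis using True by simp
    next
      case False
      then have "q - 1 \<in> cells xs (own q)" using o by (auto simp: cells_def)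
      then have "own (q - 1) = own q" using own_cell o by blast
      then show ?thesis using q by simp
    qed
    show "mate (own q) \<noteq> 0" using o by (simp only: mate_iff)
  next
    show "mate 0 = 0" using mate_iff[of 0] bounds[of 0] by (metis less_irrefl)
    fix h assume "mate h \<noteq> 0"
    then have h: "h \<in> set (concat ?L)" by (simp only: mate_iff)
    show "h < length xs" using bounds[OF h] by linarith
    show "own h = 0" using own_head[OF h] .
    obtain l where l: "l \<in> set ?L" "l \<noteq> []" "h = hd l \<and> mate h = last l \<or> h = last l \<and> mate h = hd l"
      using mem[OF h] by blast
    show "mate (mate h) = h" using l(3) mate_L[OF l(1,2)] by (elim disjE) simp_all
  qed
  interpret layout "length xs" "(!) xs" own mate by (rule L)
  show "has_multilinear_monomial p \<longleftrightarrow> ok \<and> (\<exists>S. solution S)"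
  proof
    assume "has_multilinear_monomial p"
    then obtain hs where hs: "list_all2 (\<lambda>h l. h \<in> set l) hs ?L" "inj_on ((!) xs) (\<Union>h\<in>set hs. cells xs h)"
      using has_multilinear_monomial_iff[OF reads] by blast
    have pick: "\<exists>h\<in>set hs. h \<in> set l" if l: "l \<in> set ?L" for l
    proof -
      obtain i where "i < length ?L" "?L ! i = l" using l unfolding in_set_conv_nth by blast
      then have "hs ! i \<in> set l \<and> hs ! i \<in> set hs"
        using hs(1) unfolding list_all2_conv_all_nth by auto
      then show ?thesis by blast
    qed
    from pick[of "[]"] have "[] \<notin> set ?L" by auto
    then have "ok" using ok Nil_in_clause_heads by blast
    moreover have "solution (set hs)"
      unfolding solution_def
    proof (intro conjI ballI)
      fix h assume "h \<in> {h. mate h \<noteq> 0}"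
      then have "h \<in> set (concat ?L)" by (simp only: mate_iff mem_Collect_eq)
      from mem[OF this] obtain l where l: "l \<in> set ?L" "l \<noteq> []" "h = hd l \<and> mate h = last l \<or> h = last l \<and> mate h = hd l"
        by blast
      from pick[OF l(1)] obtain k where "k \<in> set hs" "k \<in> set l" by blast
      moreover from hd_or_last[OF l(1) this(2)] have "k = hd l \<or> k = last l" .
      ultimately show "h \<in> set hs \<or> mate h \<in> set hs" using l(3) by metis
    next
      fix a b assume ab: "a \<in> set hs" "b \<in> set hs"
      show "\<not> conflict a b"
      proof
        assume "conflict a b"
        then obtain i j where ij: "i \<noteq> j" "own i = a" "own j = b" "xs ! i = xs ! j" "a \<noteq> 0" "b \<noteq> 0"
          unfolding conflict_def by blast
        then have "i \<in> cells xs a" "j \<in> cells xs b" using owner[of i] owner[of j] by simp_all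
        then have "i = j" using inj_onD[OF hs(2) ij(4)] ab by blast
        then show False using ij(1) by contradiction
      qed
    qed
    ultimately show "ok \<and> (\<exists>S. solution S)" by blast
  next
    assume "ok \<and> (\<exists>S. solution S)"
    then obtain S where "ok" and S: "solution S" by blast
    have ne: "l \<noteq> []" if "l \<in> set ?L" for l
      using that ok \<open>ok\<close> Nil_in_clause_heads by blast
    \<comment> \<open>If \<open>S\<close> contains both terms of a clause, the first one is
      kept.\<close>
    define pick where "pick l = (if hd l \<in> S then hd l else last l)" for l
    have pick: "pick l \<in> set l \<and> pick l \<in> S" if l: "l \<in> set ?L" for l
    proof -
      have "hd l \<in> set (concat ?L)" unfolding set_concat using l hd_in_set[OF ne[OF l]] by blast
      then have "mate (hd l) \<noteq> 0" by (simp only: mate_iff)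
      then have "hd l \<in> S \<or> mate (hd l) \<in> S" using S unfolding solution_def by blast
      then have "hd l \<in> S \<or> last l \<in> S" using mate_L(1)[OF l ne[OF l]] by simp
      then show ?thesis using ne[OF l] by (auto simp: pick_def)
    qed
    have "list_all2 (\<lambda>h l. h \<in> set l) (map pick ?L) ?L"
      using pick by (simp add: list_all2_map1 list_all2_same)
    moreover have "inj_on ((!) xs) (\<Union>h\<in>set (map pick ?L). cells xs h)"
    proof (rule inj_onI, rule ccontr)
      fix i j
      assume ij: "i \<in> (\<Union>h\<in>set (map pick ?L). cells xs h)" "j \<in> (\<Union>h\<in>set (map pick ?L). cells xs h)"
        "xs ! i = xs ! j" "i \<noteq> j"
      have *: "own q \<noteq> 0 \<and> own q \<in> S" if "q \<in> (\<Union>h\<in>set (map pick ?L). cells xs h)" for q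
      proof -
        obtain l where l: "l \<in> set ?L" "q \<in> cells xs (pick l)" using \<open>q \<in> _\<close> by auto
        have c: "pick l \<in> set (concat ?L)" unfolding set_concat using l(1) pick[OF l(1)] by blast
        have "own q = pick l" by (rule own_cell[OF c l(2)])
        then show ?thesis using bounds[OF c] pick[OF l(1)] by simp
      qed
      have "conflict (own i) (own j)" unfolding conflict_def using ij *[OF ij(1)] *[OF ij(2)] by blast
      then show False using S *[OF ij(1)] *[OF ij(2)] unfolding solution_def by blast
    qed
    ultimately show "has_multilinear_monomial p"
      using has_multilinear_monomial_iff[OF reads] by blast
  qed
qed

section \<open>The program: reading the input\<close>

fun seqs :: "com list \<Rightarrow> com" where
  "seqs [] = Nop"
| "seqs (c # cs) = Seq c (seqs cs)"

text \<open>
  Register \<open>20 + k\<close> holds \<open>k * N\<close>. The memory consists of blocks of \<open>N\<close> words: the input (block 0),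
  \<open>own\<close> (1), the three successor tables of the \<open>4 * N\<close> nodes (2-5, 6-9, 10-13), the marks (14-17) and
  the queue (18-21) of the searches, and the terms found to lead to their own exclusion (22). The
  \<open>mate\<close> table is the last block (5) of the first successor table.
\<close>

definition based :: "nat \<Rightarrow> (nat \<Rightarrow> nat) \<Rightarrow> bool" where
  "based N R \<longleftrightarrow> R 0 = N \<and> R 22 = 2 * N \<and> R 23 = 3 * N \<and> R 24 = 4 * N \<and> R 25 = 5 * N \<and> R 26 = 6 * N \<and>
     R 27 = 7 * N \<and> R 28 = 8 * N \<and> R 30 = 10 * N \<and> R 34 = 14 * N \<and> R 38 = 18 * N \<and> R 42 = 22 * N"

text \<open>The machine has no multiplication, so the multiples of \<open>N\<close> are built by
  additions. Register 6 is the answer so far, and register 13 counts positions in all outer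
  loops.\<close>

definition prelude :: com where
  "prelude = seqs
     [Assign 6 (Const 1), Assign 13 (Const 1),
      Assign 22 (Plus (Reg 0) (Reg 0)), Assign 23 (Plus (Reg 22) (Reg 0)),
      Assign 24 (Plus (Reg 22) (Reg 22)), Assign 25 (Plus (Reg 24) (Reg 0)),
      Assign 26 (Plus (Reg 24) (Reg 22)), Assign 27 (Plus (Reg 24) (Reg 23)),
      Assign 28 (Plus (Reg 24) (Reg 24)), Assign 30 (Plus (Reg 28) (Reg 22)),
      Assign 34 (Plus (Reg 30) (Reg 24)), Assign 38 (Plus (Reg 34) (Reg 24)),
      Assign 42 (Plus (Reg 38) (Reg 24))]"

text \<open>Registers 2 to 6 carry \<open>t\<close>, \<open>c\<close>, \<open>h\<close>,
  \<open>g\<close> and \<open>ok\<close> of \<open>parse_step\<close>.\<close>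

definition parse_body :: com where
  "parse_body = seqs
     [Cond (Less (Const 0) (Reg 2))
        (seqs [Store (Plus (Reg 0) (Reg 13)) (Reg 4), Assign 2 (Monus (Reg 2) (Const 1))])
        (Cond (Less (Const 0) (Reg 3))
          (seqs [Store (Plus (Reg 25) (Reg 13)) (Reg 5), Store (Plus (Reg 25) (Reg 5)) (Reg 13),
                 Assign 2 (Load (Reg 13)), Assign 3 (Monus (Reg 3) (Const 1)), Assign 4 (Reg 13)])
          (seqs [Assign 3 (Load (Reg 13)), Assign 5 (Plus (Reg 13) (Const 1)),
                 Cond (Equal (Reg 3) (Const 0)) (Assign 6 (Const 0)) Nop])),
      Assign 13 (Plus (Reg 13) (Const 1))]"

definition parse_loop :: com where
  "parse_loop = Loop (Less (Reg 13) (Reg 0)) parse_body"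

text \<open>All addresses used stay below \<open>23 * N\<close>; the power of two 128 fits the
  exponent of the word length condition.\<close>

locale ram =
  fixes w N :: nat
  assumes word: "128 * N + 256 \<le> 2 ^ w"
begin

lemma mod_word: "x \<le> 128 * N + 255 \<Longrightarrow> x mod 2 ^ w = x"
  using word by simp

lemma aval_const: "aval w (Const 0) s = 0" "aval w (Const (Suc 0)) s = Suc 0"
  using mod_word[of "Suc 0"] by auto

lemma based_upd: "based N R \<Longrightarrow> k < 20 \<Longrightarrow> k \<noteq> 0 \<Longrightarrow> based N (R(k := v))"
  by (simp add: based_def)

lemma prelude_run:
  assumes "length xs = N"
  shows "\<exists>R. runs w prelude (init_state xs) (max_time prelude) (R, snd (init_state xs)) \<and> based N R \<and>
    R 13 = 1 \<and> R 2 = 0 \<and> R 3 = 0 \<and> R 4 = 0 \<and> R 5 = 0 \<and> R 6 = 1"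
proof -
  let ?s = "run w prelude (init_state xs)"
  have runs: "runs w prelude (init_state xs) (max_time prelude) ?s"
    by (rule runs_run) (simp add: prelude_def)
  have mem: "snd ?s = snd (init_state xs)"
    by (simp add: prelude_def)
  have "based N (fst ?s) \<and> fst ?s 13 = 1 \<and> fst ?s 2 = 0 \<and> fst ?s 3 = 0 \<and> fst ?s 4 = 0 \<and> fst ?s 5 = 0 \<and> fst ?s 6 = 1"
    using assms by (simp add: prelude_def init_state_def based_def mod_word aval_const del: aval.simps(1))
  then show ?thesis
    using runs mem by (metis prod.collapse)
qed

text \<open>Describing the entire memory turns each store into an update of \<open>own\<close> or
  \<open>mate\<close>, so that memory and fold proceed in step.\<close>

definition parse_mem :: "nat list \<Rightarrow> (nat \<Rightarrow> nat) \<Rightarrow> (nat \<Rightarrow> nat) \<Rightarrow> nat \<Rightarrow> nat" where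
  "parse_mem xs own mate a =
     (if a < N then xs ! a else if a < 2 * N then own (a - N)
      else if 5 * N \<le> a \<and> a < 6 * N then mate (a - 5 * N) else 0)"

lemma parse_mem_own: "i < N \<Longrightarrow> (parse_mem xs own mate)(N + i := v) = parse_mem xs (own(i := v)) mate"
  by (auto simp: parse_mem_def fun_eq_iff)

lemma parse_mem_mate: "i < N \<Longrightarrow> (parse_mem xs own mate)(5 * N + i := v) = parse_mem xs own (mate(i := v))"
  by (auto simp: parse_mem_def fun_eq_iff)

lemma parse_mem_input: "i < N \<Longrightarrow> parse_mem xs own mate i = xs ! i"
  by (simp add: parse_mem_def)

text \<open>The conjunct \<open>g \<le> i\<close> keeps the store at \<open>5 * N + g\<close> inside
  the mate block, since \<open>i < N\<close> whenever the body runs.\<close>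

definition parse_inv :: "nat list \<Rightarrow> nat \<Rightarrow> state \<Rightarrow> bool" where
  "parse_inv xs i s \<longleftrightarrow> (\<exists>own mate t c h g ok.
     fold (parse_step xs) [1..<i] (\<lambda>_. 0, \<lambda>_. 0, 0, 0, 0, 0, True) = (own, mate, t, c, h, g, ok) \<and>
     1 \<le> i \<and> i \<le> N \<and> g \<le> i \<and> based N (fst s) \<and> fst s 13 = i \<and> fst s 2 = t \<and> fst s 3 = c \<and> fst s 4 = h \<and>
     fst s 5 = g \<and> fst s 6 = of_bool ok \<and> snd s = parse_mem xs own mate)"

lemma parse_body_run:
  assumes "parse_inv xs i s" and "i < N"
  shows "parse_inv xs (Suc i) (run w parse_body s)"
proof -
  obtain R m where s: "s = (R, m)" by fastforce
  obtain own mate t c h g ok where st: "fold (parse_step xs) [1..<i] (\<lambda>_. 0, \<lambda>_. 0, 0, 0, 0, 0, True) = (own, mate, t, c, h, g, ok)"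
    and i: "1 \<le> i" "g \<le> i" and b: "based N R"
    and R: "R 13 = i" "R 2 = t" "R 3 = c" "R 4 = h" "R 5 = g" "R 6 = of_bool ok" and m: "m = parse_mem xs own mate"
    using assms(1) unfolding parse_inv_def s by auto
  have fold: "fold (parse_step xs) [1..<Suc i] (\<lambda>_. 0, \<lambda>_. 0, 0, 0, 0, 0, True) = parse_step xs i (own, mate, t, c, h, g, ok)"
    using st i(1) by simp
  have b': "R 0 = N" "R 25 = 5 * N" using b by (simp_all add: based_def)
  note sums = mod_word[of "N + i"] mod_word[of "5 * N + i"]
      mod_word[of "5 * N + g"] mod_word[of "Suc i"]
  show ?thesis
    unfolding parse_inv_def fold
    using i assms(2) b sums
    by (cases "0 < t"; cases "0 < c")
      (simp_all add: parse_body_def s R b' m parse_mem_own parse_mem_mate parse_mem_input based_upd aval_const del: aval.simps(1))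
qed

lemma parse_loop_run:
  assumes "parse_inv xs 1 s"
  shows "\<exists>s'. runs w parse_loop s (loop_time (Less (Reg 13) (Reg 0)) N (max_time parse_body)) s' \<and> parse_inv xs N s'"
proof -
  let ?I = "\<lambda>s. parse_inv xs (fst s 13) s" and ?b = "Less (Reg 13) (Reg 0)"
  have R1: "parse_inv xs i s \<Longrightarrow> fst s 13 = i \<and> i \<le> N \<and> fst s 0 = N" for i s
    by (auto simp: parse_inv_def based_def)
  have "\<exists>s'. runs w parse_loop s (loop_time ?b N (max_time parse_body)) s' \<and> ?I s' \<and> \<not> bval w ?b s'"
    unfolding parse_loop_def
  proof (rule runs_bounded_Loop[where I = ?I and \<mu> = "\<lambda>s. N - fst s 13"])
    fix s assume I: "?I s" and "bval w ?b s"
    then have less: "fst s 13 < N" using R1[OF I] by simp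
    have "parse_inv xs (Suc (fst s 13)) (run w parse_body s)"
      by (rule parse_body_run[OF I less])
    moreover have "runs w parse_body s (max_time parse_body) (run w parse_body s)"
      by (rule runs_run) (simp add: parse_body_def)
    ultimately show "\<exists>s'. runs w parse_body s (max_time parse_body) s' \<and> ?I s' \<and> N - fst s' 13 < N - fst s 13"
      using R1 less by (intro exI[of _ "run w parse_body s"]) (metis diff_less_mono2 lessI)
  next
    show "?I s" using assms R1 by metis
  qed simp
  then obtain s' where s': "runs w parse_loop s (loop_time ?b N (max_time parse_body)) s'"
    "?I s'" "\<not> bval w ?b s'" by blast
  have "fst s' 13 = N" using R1[OF s'(2)] s'(3) by simp
  then show ?thesis using s'(1,2) by metis
qed

end

section \<open>The program: building the graph\<close>

definition scan_body :: com where
  "scan_body = seqs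
     [Cond (Conj (Less (Const 0) (Load (Plus (Reg 0) (Reg 7)))) (Equal (Load (Reg 7)) (Load (Reg 13))))
        (Assign 8 (Reg 7)) Nop,
      Assign 7 (Plus (Reg 7) (Const 1))]"

text \<open>Node \<open>u\<close> has its slots at \<open>2 * N + u\<close>,
  \<open>6 * N + u\<close> and \<open>10 * N + u\<close>. The edges \<open>next_cell\<close>,
  \<open>exclude_F\<close>, \<open>exclude_B\<close> and \<open>choose_mate\<close> use the first
  table, \<open>start_F\<close>, \<open>step_F\<close> and \<open>step_B\<close> the second,
  \<open>start_B\<close> the third; thus no two edges compete for a slot.\<close>

definition link_cell :: com where
  "link_cell = seqs
     [Assign 9 (Load (Plus (Reg 0) (Reg 13))),
      Cond (Less (Const 0) (Reg 9))
        (seqs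
          [Store (Plus (Reg 22) (Monus (Reg 13) (Const 1))) (Reg 13),
           Store (Plus (Reg 23) (Reg 13)) (Plus (Reg 23) (Reg 9)),
           Store (Plus (Reg 24) (Reg 13)) (Plus (Reg 23) (Reg 9)),
           Cond (Less (Const 0) (Reg 8))
             (seqs
               [Store (Plus (Reg 26) (Reg 8)) (Plus (Reg 0) (Reg 13)),
                Store (Plus (Reg 27) (Reg 8)) (Plus (Reg 0) (Reg 13)),
                Store (Plus (Reg 30) (Reg 13)) (Plus (Reg 22) (Reg 8)),
                Store (Plus (Reg 28) (Reg 13)) (Plus (Reg 22) (Reg 8))])
             Nop])
        Nop,
      Assign 13 (Plus (Reg 13) (Const 1))]"

definition link_body :: com where
  "link_body = seqs
     [seqs [Assign 7 (Const 0), Assign 8 (Const 0)], Loop (Less (Reg 7) (Reg 13)) scan_body, link_cell]"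

definition link_loop :: com where
  "link_loop = seqs [Assign 13 (Const 1), Loop (Less (Reg 13) (Reg 0)) link_body]"

definition link_body_time :: "nat \<Rightarrow> nat" where
  "link_body_time N = 1 + max_time (seqs [Assign 7 (Const 0), Assign 8 (Const 0)]) +
     (1 + loop_time (Less (Reg 7) (Reg 13)) N (max_time scan_body) + (1 + max_time link_cell + 1))"

definition link_time :: "nat \<Rightarrow> nat" where
  "link_time N = 1 + max_time (Assign 13 (Const 1)) + (1 + loop_time (Less (Reg 13) (Reg 0)) N (link_body_time N) + 1)"

context ram
begin

definition graph :: "(nat \<Rightarrow> nat) \<Rightarrow> nat \<Rightarrow> nat \<Rightarrow> bool" where
  "graph m u v \<longleftrightarrow> u < 4 * N \<and> (v = m (2 * N + u) \<or> v = m (6 * N + u) \<or> v = m (10 * N + u))"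

lemma run_link_cell:
  assumes "based N R" and R: "R 13 = i" "R 8 = l" and i: "1 \<le> i" "i < N" and l: "l < N" and x: "m (N + i) = x" "x < N"
  shows "run w link_cell (R, m) = (R(9 := x, 13 := Suc i),
    if x = 0 then m else if l = 0 then m(2 * N + (i - 1) := i, 3 * N + i := 3 * N + x, 4 * N + i := 3 * N + x)
    else m(2 * N + (i - 1) := i, 3 * N + i := 3 * N + x, 4 * N + i := 3 * N + x,
      6 * N + l := N + i, 7 * N + l := N + i, 10 * N + i := 2 * N + l, 8 * N + i := 2 * N + l))"
proof -
  have sums: "(N + i) mod 2 ^ w = N + i" "Suc i mod 2 ^ w = Suc i"
    "(2 * N + (i - Suc 0)) mod 2 ^ w = 2 * N + (i - Suc 0)"
    "(3 * N + i) mod 2 ^ w = 3 * N + i" "(4 * N + i) mod 2 ^ w = 4 * N + i" "(3 * N + x) mod 2 ^ w = 3 * N + x"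
    "(6 * N + l) mod 2 ^ w = 6 * N + l" "(7 * N + l) mod 2 ^ w = 7 * N + l"
    "(2 * N + l) mod 2 ^ w = 2 * N + l" "(10 * N + i) mod 2 ^ w = 10 * N + i" "(8 * N + i) mod 2 ^ w = 8 * N + i"
    using i l x by (simp_all add: mod_word)
  have bs: "R 0 = N" "R 22 = 2 * N" "R 23 = 3 * N" "R 24 = 4 * N" "R 26 = 6 * N" "R 27 = 7 * N" "R 28 = 8 * N" "R 30 = 10 * N"
    using assms(1) unfolding based_def by simp_all
  show ?thesis
    by (simp add: sums bs R x(1) link_cell_def aval_const del: aval.simps(1))
qed

end

section \<open>Invariants of the successor tables\<close>

locale ram_layout = ram w N + layout N val own mate for w N val own mate
begin

definition input_mem :: "(nat \<Rightarrow> nat) \<Rightarrow> bool" where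
  "input_mem m \<longleftrightarrow> (\<forall>q<N. m q = val q \<and> m (N + q) = own q \<and> m (5 * N + q) = mate q)"

definition sound_mem :: "(nat \<Rightarrow> nat) \<Rightarrow> bool" where
  "sound_mem m \<longleftrightarrow> (\<forall>u<4 * N. \<forall>k\<in>{2 * N, 6 * N, 10 * N}. m (k + u) = 0 \<or> edge u (m (k + u)))"

definition linked :: "(nat \<Rightarrow> nat) \<Rightarrow> nat \<Rightarrow> bool" where
  "linked m q \<longleftrightarrow> m (2 * N + (q - 1)) = q \<and> m (3 * N + q) = 3 * N + own q \<and> m (4 * N + q) = 3 * N + own q \<and>
     (prv q \<noteq> 0 \<longrightarrow> m (6 * N + prv q) = N + q \<and> m (7 * N + prv q) = N + q \<and>
        m (10 * N + q) = 2 * N + prv q \<and> m (8 * N + q) = 2 * N + prv q)"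

text \<open>The tables lie \<open>4 * N\<close> apart and \<open>u < 4 * N\<close>, so an address
  determines both its table and its node.\<close>

lemma sound_mem_upd:
  assumes "sound_mem m" and "edge u v" and "u < 4 * N" and "k \<in> {2 * N, 6 * N, 10 * N}" and "a = k + u"
  shows "sound_mem (m(a := v))"
  unfolding sound_mem_def
proof (intro allI impI ballI)
  fix u' k' assume u': "u' < 4 * N" "k' \<in> {2 * N, 6 * N, 10 * N}"
  show "(m(a := v)) (k' + u') = 0 \<or> edge u' ((m(a := v)) (k' + u'))"
  proof (cases "k' + u' = a")
    case True
    then have "u' = u" using u' assms(3-5) by auto
    then show ?thesis using True assms(2) by simp
  next
    case False
    then have "(m(a := v)) (k' + u') = m (k' + u')" by simp
    then show ?thesis using assms(1) u' unfolding sound_mem_def by (simp only:)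
  qed
qed

text \<open>The memory from \<open>14 * N\<close> on stays clear, so that the first search finds no
  marks.\<close>

definition link_inv :: "nat \<Rightarrow> nat \<Rightarrow> state \<Rightarrow> bool" where
  "link_inv e i s \<longleftrightarrow> based N (fst s) \<and> fst s 13 = i \<and> fst s 6 = e \<and> 1 \<le> i \<and> i \<le> N \<and>
     input_mem (snd s) \<and> sound_mem (snd s) \<and> (\<forall>a\<ge>14 * N. snd s a = 0) \<and>
     (\<forall>q<i. own q \<noteq> 0 \<longrightarrow> linked (snd s) q)"

lemma scan_run:
  assumes "based N R" and "R 13 = i" and "i < N" and "R 7 = 0" and "R 8 = 0" and "input_mem m"
  shows "\<exists>R'. runs w (Loop (Less (Reg 7) (Reg 13)) scan_body) (R, m)
      (loop_time (Less (Reg 7) (Reg 13)) N (max_time scan_body)) (R', m) \<and>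
    based N R' \<and> R' 13 = i \<and> R' 6 = R 6 \<and> R' 8 = prv i"
proof -
  let ?I = "\<lambda>s. based N (fst s) \<and> fst s 13 = i \<and> fst s 6 = R 6 \<and> fst s 7 \<le> i \<and>
    fst s 8 = last_match i (fst s 7) \<and> snd s = m" and ?b = "Less (Reg 7) (Reg 13)"
  have "\<exists>s'. runs w (Loop ?b scan_body) (R, m) (loop_time ?b N (max_time scan_body)) s' \<and> ?I s' \<and> \<not> bval w ?b s'"
  proof (rule runs_bounded_Loop[where I = ?I and \<mu> = "\<lambda>s. i - fst s 7"])
    fix s assume I: "?I s" and "bval w ?b s"
    then have less: "fst s 7 < i" by simp
    have x: "(N + fst s 7) mod 2 ^ w = N + fst s 7" "Suc (fst s 7) mod 2 ^ w = Suc (fst s 7)"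
      using less assms(3) by (simp_all add: mod_word)
    have m: "m (N + fst s 7) = own (fst s 7)" "m (fst s 7) = val (fst s 7)" "m i = val i"
      using assms(6) less assms(3) unfolding input_mem_def by simp_all
    have "?I (run w scan_body s) \<and> fst (run w scan_body s) 7 = Suc (fst s 7)"
      using I less x m unfolding based_def by (simp add: scan_body_def aval_const del: aval.simps(1))
    moreover have "runs w scan_body s (max_time scan_body) (run w scan_body s)"
      by (rule runs_run) (simp add: scan_body_def)
    ultimately show "\<exists>s'. runs w scan_body s (max_time scan_body) s' \<and> ?I s' \<and> i - fst s' 7 < i - fst s 7"
      using diff_less_mono2[OF lessI less] by (intro exI[of _ "run w scan_body s"]) simp
  qed (use assms in simp_all)
  then obtain s' where s': "runs w (Loop ?b scan_body) (R, m) (loop_time ?b N (max_time scan_body)) s'"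
    "?I s'" "\<not> bval w ?b s'" by blast
  then have "fst s' 7 = i" by simp
  then show ?thesis using s'(1,2) by (metis prod.collapse)
qed

lemma link_cell_run:
  assumes inv: "link_inv e i (R, m)" and i: "i < N" and L: "R 8 = prv i"
  shows "link_inv e (Suc i) (run w link_cell (R, m))"
proof -
  have b: "based N R" and R: "R 13 = i" "R 6 = e" and i1: "1 \<le> i" and inp: "input_mem m" and snd: "sound_mem m"
    and z: "\<forall>a\<ge>14 * N. m a = 0" and lk: "\<And>q. q < i \<Longrightarrow> own q \<noteq> 0 \<Longrightarrow> linked m q"
    using inv unfolding link_inv_def by auto
  let ?m1 = "m(2 * N + (i - 1) := i, 3 * N + i := 3 * N + own i, 4 * N + i := 3 * N + own i)"
  let ?m2 = "?m1(6 * N + prv i := N + i, 7 * N + prv i := N + i, 10 * N + i := 2 * N + prv i, 8 * N + i := 2 * N + prv i)"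
  let ?m = "if own i = 0 then m else if prv i = 0 then ?m1 else ?m2"
  have pN: "prv i < N" using last_match_matches[of i i] i by (cases "prv i = 0") auto
  have oN: "own i < N" using owner_less[of i] i by (cases "own i = 0") auto
  have mi: "m (N + i) = own i" using inp i unfolding input_mem_def by simp
  have run: "run w link_cell (R, m) = (R(9 := own i, 13 := Suc i), ?m)"
    by (rule run_link_cell[where R = R and m = m and i = i and x = "own i" and l = "prv i", OF b R(1) L i1 i pN mi oN])
  have inp': "input_mem ?m"
    using inp i1 i pN unfolding input_mem_def by auto
  have z': "\<forall>a\<ge>14 * N. ?m a = 0"
    using z i1 i pN by auto
  have snd': "sound_mem ?m"
  proof -
    have 1: "sound_mem ?m1" if o: "own i \<noteq> 0"
    proof -
      have "sound_mem (m(2 * N + (i - 1) := i))"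
        using i by (intro sound_mem_upd[OF snd next_cell[OF o], where k = "2 * N"]) auto
      then have "sound_mem (m(2 * N + (i - 1) := i, 3 * N + i := 3 * N + own i))"
        by (rule sound_mem_upd[where k = "2 * N", OF _ exclude_F[OF o]]) (use i in auto)
      then show ?thesis
        by (rule sound_mem_upd[where k = "2 * N", OF _ exclude_B[OF o]]) (use i in auto)
    qed
    have 2: "sound_mem ?m2" if o: "own i \<noteq> 0" and p: "prv i \<noteq> 0"
    proof -
      have "sound_mem (?m1(6 * N + prv i := N + i))"
        by (rule sound_mem_upd[where k = "6 * N", OF 1[OF o] start_F[OF o p]]) (use pN in auto)
      then have "sound_mem (?m1(6 * N + prv i := N + i, 7 * N + prv i := N + i))"
        by (rule sound_mem_upd[where k = "6 * N", OF _ step_F[OF o p]]) (use pN in auto)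
      then have "sound_mem (?m1(6 * N + prv i := N + i, 7 * N + prv i := N + i, 10 * N + i := 2 * N + prv i))"
        by (rule sound_mem_upd[where k = "10 * N", OF _ start_B[OF o p]]) (use i in auto)
      then show ?thesis
        by (rule sound_mem_upd[where k = "6 * N", OF _ step_B[OF o p]]) (use i in auto)
    qed
    show ?thesis using snd 1 2 by (cases "own i = 0"; cases "prv i = 0") simp_all
  qed
  have lk': "linked ?m q" if q: "q < Suc i" "own q \<noteq> 0" for q
  proof (cases "q = i")
    case True
    have "linked ?m1 i" if "prv i = 0"
      using that i i1 unfolding linked_def by auto
    moreover have "linked ?m2 i"
      using i i1 pN unfolding linked_def by auto
    ultimately show ?thesis using True q(2) by simp
  next
    case False
    then have "q < i" using q by simp
    note lkq = lk[OF \<open>q < i\<close> q(2)]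
    show ?thesis
    proof (cases "own i = 0")
      case True
      then show ?thesis using lkq by simp
    next
      case False
      let ?W = "{2 * N + (i - 1), 3 * N + i, 4 * N + i, 6 * N + prv i, 7 * N + prv i, 10 * N + i, 8 * N + i}"
      define M where "M = ?m"
      have old: "M a = m a" if "a \<notin> ?W" for a
        using that by (simp add: M_def)
      have q0: "0 < q" using own_less[OF q(2)] by simp
      \<comment> \<open>Distinct occurrences of a variable have distinct predecessors: a common
        predecessor of \<open>q\<close> and \<open>i\<close> would have \<open>q\<close> strictly
        between it and \<open>i\<close>. So the slots filled at \<open>prv q\<close>
        survive.\<close>
      have new: "prv q < q \<and> prv q \<noteq> prv i" if p: "prv q \<noteq> 0"
      proof -
        note mq = last_match_matches[OF p]
        have False if eq: "prv q = prv i"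
        proof -
          have "val q = val i" using mq last_match_matches[of i i] p unfolding eq by metis
          then have "q \<le> prv i" using last_match_ge[of q i i] q(2) \<open>q < i\<close> by blast
          then show False using eq mq by simp
        qed
        then show ?thesis using mq by blast
      qed
      have W: "2 * N + (q - 1) \<notin> ?W" "3 * N + q \<notin> ?W" "4 * N + q \<notin> ?W" "10 * N + q \<notin> ?W" "8 * N + q \<notin> ?W"
        using \<open>q < i\<close> q0 i pN by auto
      have W': "6 * N + prv q \<notin> ?W" "7 * N + prv q \<notin> ?W" if "prv q \<noteq> 0"
        using new[OF that] \<open>q < i\<close> i pN by auto
      have "linked M q"
        using lkq old[OF W(1)] old[OF W(2)] old[OF W(3)] old[OF W(4)] old[OF W(5)] old[OF W'(1)] old[OF W'(2)]
        unfolding linked_def by simp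
      then show ?thesis unfolding M_def .
    qed
  qed
  have "based N (R(9 := own i, 13 := Suc i))"
    by (intro based_upd b) simp_all
  then show ?thesis
    unfolding run link_inv_def fst_conv snd_conv
    by (intro conjI inp' snd' z' allI impI lk') (use R i in simp_all)
qed

lemma link_body_run:
  assumes inv: "link_inv e i s" and i: "i < N"
  shows "\<exists>s'. runs w link_body s (link_body_time N) s' \<and> link_inv e (Suc i) s'"
proof -
  obtain R m where s: "s = (R, m)" by fastforce
  have b: "based N R" and R: "R 13 = i" "R 6 = e" and inp: "input_mem m"
    using inv unfolding link_inv_def s by auto
  let ?R = "R(7 := 0, 8 := 0)" and ?init = "seqs [Assign 7 (Const 0), Assign 8 (Const 0)]"
  have 1: "runs w ?init s (max_time ?init) (?R, m)"
    using runs_run[of ?init w s] by (simp add: s)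
  obtain R' where R': "runs w (Loop (Less (Reg 7) (Reg 13)) scan_body) (?R, m)
      (loop_time (Less (Reg 7) (Reg 13)) N (max_time scan_body)) (R', m)"
    "based N R'" "R' 13 = i" "R' 6 = ?R 6" "R' 8 = prv i"
    using scan_run[of ?R i m] based_upd[OF based_upd[OF b, of 7 0], of 8 0] R i inp by auto
  have "link_inv e i (R', m)"
    using inv R' R unfolding link_inv_def s by simp
  then have "link_inv e (Suc i) (run w link_cell (R', m))"
    using link_cell_run i R'(5) by blast
  moreover have 3: "runs w link_cell (R', m) (max_time link_cell) (run w link_cell (R', m))"
    by (rule runs_run) (simp add: link_cell_def)
  ultimately show ?thesis
    using runs_Seq[OF 1 runs_Seq[OF R'(1) runs_Seq[OF 3 runs_Nop]]]
    unfolding link_body_def link_body_time_def seqs.simps by blast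
qed

lemma link_loop_run:
  assumes b: "based N R" and R: "R 6 = e" and N: "0 < N" and inp: "input_mem m"
    and z: "\<And>a. 2 * N \<le> a \<Longrightarrow> \<not> (5 * N \<le> a \<and> a < 6 * N) \<Longrightarrow> m a = 0"
  shows "\<exists>s'. runs w link_loop (R, m) (link_time N) s' \<and> link_inv e N s'"
proof -
  let ?I = "\<lambda>s. link_inv e (fst s 13) s" and ?b = "Less (Reg 13) (Reg 0)"
  let ?s = "(R(13 := 1), m)"
  have 1: "runs w (Assign 13 (Const 1)) (R, m) (max_time (Assign 13 (Const 1))) ?s"
    using runs_run[of "Assign 13 (Const 1)" w "(R, m)"] by (simp add: aval_const del: aval.simps(1))
  have R1: "link_inv e i s \<Longrightarrow> fst s 13 = i \<and> i \<le> N \<and> fst s 0 = N" for i s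
    by (auto simp: link_inv_def based_def)
  have own0: "own 0 = 0" using own_less[of 0] by auto
  have "sound_mem m"
    unfolding sound_mem_def
  proof (intro allI impI ballI)
    fix u k assume u: "u < 4 * N" "k \<in> {2 * N, 6 * N, 10 * N}"
    show "m (k + u) = 0 \<or> edge u (m (k + u))"
    proof (cases "5 * N \<le> k + u \<and> k + u < 6 * N")
      \<comment> \<open>The mate block is the part of the first table that belongs to the exclusion
        nodes: the parser has already stored the edges \<open>choose_mate\<close>.\<close>
      case True
      then have "u = 3 * N + (u - 3 * N)" "u - 3 * N < N" "k + u = 5 * N + (u - 3 * N)" using u by auto
      moreover from this have "m (k + u) = mate (u - 3 * N)" using inp unfolding input_mem_def by metis
      ultimately show ?thesis using choose_mate[of "u - 3 * N"] by metis
    next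
      case False
      then show ?thesis using u z[of "k + u"] by auto
    qed
  qed
  then have inv: "?I ?s"
    using b based_upd[OF b, of 13 1] R N inp z own0 unfolding link_inv_def by auto
  have "\<exists>s'. runs w (Loop ?b link_body) ?s (loop_time ?b N (link_body_time N)) s' \<and> ?I s' \<and> \<not> bval w ?b s'"
  proof (rule runs_bounded_Loop[where I = ?I and \<mu> = "\<lambda>s. N - fst s 13"])
    fix s assume I: "?I s" and "bval w ?b s"
    then have less: "fst s 13 < N" using R1[OF I] by simp
    obtain s' where s': "runs w link_body s (link_body_time N) s'" "link_inv e (Suc (fst s 13)) s'"
      using link_body_run[OF I less] by blast
    then show "\<exists>s'. runs w link_body s (link_body_time N) s' \<and> ?I s' \<and> N - fst s' 13 < N - fst s 13"
      using R1[OF s'(2)] diff_less_mono2[OF lessI less] by (intro exI[of _ s']) simp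
  qed (use inv in simp_all)
  then obtain s' where s': "runs w (Loop ?b link_body) ?s (loop_time ?b N (link_body_time N)) s'" "?I s'" "\<not> bval w ?b s'"
    by blast
  have "fst s' 13 = N" using R1[OF s'(2)] s'(3) by simp
  then show ?thesis
    using s'(2) runs_Seq[OF 1 runs_Seq[OF s'(1) runs_Nop]]
    unfolding link_loop_def link_time_def seqs.simps by metis
qed

lemma graph_edge:
  assumes "link_inv e N s"
  shows "graph (snd s) u v \<Longrightarrow> edge u v \<or> v = 0" and "edge u v \<Longrightarrow> graph (snd s) u v"
proof -
  let ?m = "snd s"
  have inp: "input_mem ?m" and snd: "sound_mem ?m" and lk: "\<And>q. own q \<noteq> 0 \<Longrightarrow> linked ?m q"
    using assms own_less unfolding link_inv_def by auto
  show "graph ?m u v \<Longrightarrow> edge u v \<or> v = 0"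
    using snd unfolding graph_def sound_mem_def by auto
  assume "edge u v"
  then show "graph ?m u v"
  proof (cases rule: edge.cases)
    case next_cell
    then show ?thesis using lk[of v] own_less[of v] unfolding linked_def graph_def by auto
  next
    case (exclude_F q)
    then show ?thesis using lk[of q] own_less[of q] unfolding linked_def graph_def by simp
  next
    case (exclude_B q)
    then show ?thesis using lk[of q] own_less[of q] unfolding linked_def graph_def by simp
  next
    case (choose_mate h)
    then show ?thesis using inp mate_less[of h] unfolding input_mem_def graph_def by simp
  next
    case (start_F q)
    then show ?thesis using lk[of q] own_less[of q] last_match_matches[of q q] unfolding linked_def graph_def by simp
  next
    case (step_F q)
    then show ?thesis using lk[of q] own_less[of q] last_match_matches[of q q] unfolding linked_def graph_def by simp
  next
    case start_B
    then show ?thesis using lk[of u] own_less[of u] unfolding linked_def graph_def by simp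
  next
    case (step_B q)
    then show ?thesis using lk[of q] own_less[of q] unfolding linked_def graph_def by simp
  qed
qed

end

section \<open>The program: searching the graph\<close>

text \<open>Register 2 holds the stamp of the search, 9 the node being expanded, 10 and 11 the two
  ends of the queue, and 12 the successor.\<close>

definition visit :: "nat \<Rightarrow> com" where
  "visit k = seqs
     [Assign 12 (Load (Plus (Reg k) (Reg 9))),
      Cond (Equal (Load (Plus (Reg 34) (Reg 12))) (Reg 2)) Nop
        (seqs
          [Store (Plus (Reg 34) (Reg 12)) (Reg 2),
           Store (Plus (Reg 38) (Reg 11)) (Reg 12),
           Assign 11 (Plus (Reg 11) (Const 1))])]"

definition bfs_pop :: com where
  "bfs_pop = seqs [Assign 9 (Load (Plus (Reg 38) (Reg 10))), Assign 10 (Plus (Reg 10) (Const 1))]"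

definition bfs_body :: com where
  "bfs_body = Seq bfs_pop (Seq (visit 22) (Seq (visit 26) (visit 30)))"

text \<open>The search from \<open>v\<close> marks with \<open>v + 1\<close>, so that marks need not be cleared.\<close>

definition search_init :: com where
  "search_init = seqs
     [Assign 2 (Plus (Reg 13) (Const 1)), Store (Plus (Reg 34) (Reg 13)) (Reg 2),
      Store (Reg 38) (Reg 13), Assign 10 (Const 0), Assign 11 (Const 1)]"

text \<open>The flag of \<open>v\<close> is set before that of its mate is read, so a one-term
  clause is rejected by the single search from its term.\<close>

definition search_test :: com where
  "search_test = seqs
     [Cond (Equal (Load (Plus (Reg 34) (Plus (Reg 23) (Reg 13)))) (Reg 2))
        (seqs
          [Store (Plus (Reg 42) (Reg 13)) (Const 1),
           Cond (Equal (Load (Plus (Reg 42) (Load (Plus (Reg 25) (Reg 13))))) (Const 1))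
             (Assign 6 (Const 0)) Nop])
        Nop,
      Assign 13 (Plus (Reg 13) (Const 1))]"

definition search_body :: com where
  "search_body = Seq search_init (Seq (Loop (Less (Reg 10) (Reg 11)) bfs_body) search_test)"

text \<open>Register 0 holds \<open>N\<close> as the loop bound, so the answer is moved there only
  at the end.\<close>

definition search_loop :: com where
  "search_loop = Seq (Assign 13 (Const 0)) (Seq (Loop (Less (Reg 13) (Reg 0)) search_body) (Assign 0 (Reg 6)))"

definition enqueue :: "'a list \<Rightarrow> 'a \<Rightarrow> 'a list" where
  "enqueue q y = (if y \<in> set q then q else q @ [y])"

lemma set_enqueue [simp]: "set (enqueue q y) = insert y (set q)"
  by (auto simp: enqueue_def)

lemma take_enqueue: "h \<le> length q \<Longrightarrow> take h (enqueue q y) = take h q"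
  by (simp add: enqueue_def)

lemma length_enqueue: "length q \<le> length (enqueue q y)"
  by (simp add: enqueue_def)

definition bfs_body_time :: nat where
  "bfs_body_time = 1 + max_time bfs_pop + (1 + max_time (visit 22) + (1 + max_time (visit 26) + max_time (visit 30)))"

definition search_body_time :: "nat \<Rightarrow> nat" where
  "search_body_time N = 1 + max_time search_init +
     (1 + loop_time (Less (Reg 10) (Reg 11)) (4 * N) bfs_body_time + max_time search_test)"

definition search_time :: "nat \<Rightarrow> nat" where
  "search_time N = 1 + max_time (Assign 13 (Const 0)) +
     (1 + loop_time (Less (Reg 13) (Reg 0)) N (search_body_time N) + max_time (Assign 0 (Reg 6)))"

section \<open>Correctness of the searches\<close>

context ram
begin

text \<open>Marks left by earlier searches are at most \<open>v\<close>, so the stamp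
  \<open>Suc v\<close> singles out the nodes queued in the present one.\<close>

definition bfs :: "nat \<Rightarrow> (nat \<Rightarrow> nat) \<Rightarrow> nat \<Rightarrow> nat list \<Rightarrow> nat \<Rightarrow> state \<Rightarrow> bool" where
  "bfs e m0 v q h s \<longleftrightarrow> based N (fst s) \<and> fst s 13 = v \<and> fst s 6 = e \<and> fst s 2 = Suc v \<and>
     fst s 10 = h \<and> fst s 11 = length q \<and> (\<forall>a. a < 14 * N \<or> 22 * N \<le> a \<longrightarrow> snd s a = m0 a) \<and>
     distinct q \<and> set q \<subseteq> {..<4 * N} \<and> h \<le> length q \<and> (\<forall>i<length q. snd s (18 * N + i) = q ! i) \<and>
     (\<forall>u\<in>set q. snd s (14 * N + u) = Suc v) \<and> (\<forall>u<4 * N. u \<notin> set q \<longrightarrow> snd s (14 * N + u) \<le> v)"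

text \<open>No node is queued twice; this bounds both the space for the queue and the number of
  rounds.\<close>

lemma queue_length: "distinct q \<Longrightarrow> set q \<subseteq> {..<4 * N} \<Longrightarrow> length q \<le> 4 * N"
  by (metis card_lessThan card_mono distinct_card finite_lessThan)

lemma visit_run:
  assumes bfs: "bfs e m0 v q h (R, m)" and u: "R 9 = u" "u < 4 * N" and k: "R k = b" "b \<in> {2 * N, 6 * N, 10 * N}" "k \<noteq> 12"
    and y: "m0 (b + u) = y" "y < 4 * N"
  shows "\<exists>R' m'. runs w (visit k) (R, m) (max_time (visit k)) (R', m') \<and> R' 9 = u \<and> bfs e m0 v (enqueue q y) h (R', m')"
proof -
  have b: "based N R" and R: "R 13 = v" "R 6 = e" "R 2 = Suc v" "R 10 = h" "R 11 = length q"
    and m0: "\<And>a. a < 14 * N \<or> 22 * N \<le> a \<Longrightarrow> m a = m0 a" and q: "distinct q" "set q \<subseteq> {..<4 * N}" "h \<le> length q"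
    and queue: "\<And>i. i < length q \<Longrightarrow> m (18 * N + i) = q ! i"
    and mark: "\<And>u. u \<in> set q \<Longrightarrow> m (14 * N + u) = Suc v" "\<And>u. u < 4 * N \<Longrightarrow> u \<notin> set q \<Longrightarrow> m (14 * N + u) \<le> v"
    using bfs unfolding bfs_def by auto
  have my: "m (b + u) = y" using m0[of "b + u"] k u y by auto
  have bs: "R 34 = 14 * N" "R 38 = 18 * N" using b unfolding based_def by simp_all
  have runs: "runs w (visit k) (R, m) (max_time (visit k)) (run w (visit k) (R, m))"
    by (rule runs_run) (simp add: visit_def)
  have sums: "(b + u) mod 2 ^ w = b + u" "(14 * N + y) mod 2 ^ w = 14 * N + y"
    using k(2) u y by (auto intro!: mod_word)
  show ?thesis
  proof (cases "y \<in> set q")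
    case True
    have "run w (visit k) (R, m) = (R(12 := y), m)"
      using mark(1)[OF True] bs R u k my sums by (simp add: visit_def)
    moreover have "bfs e m0 v q h (R(12 := y), m)"
      using bfs based_upd[OF b, of 12 y] unfolding bfs_def by simp
    ultimately show ?thesis
      using runs u True by (intro exI[of _ "R(12 := y)"] exI[of _ m]) (simp add: enqueue_def)
  next
    case False
    have "Suc (length q) \<le> 4 * N"
      using queue_length[of "q @ [y]"] q y False by simp
    then have sums': "(18 * N + length q) mod 2 ^ w = 18 * N + length q" "Suc (length q) mod 2 ^ w = Suc (length q)" and len: "length q < 4 * N"
      by (auto intro!: mod_word)
    let ?R = "R(12 := y, 11 := Suc (length q))" and ?m = "m(14 * N + y := Suc v, 18 * N + length q := y)"
    have "m (14 * N + y) \<noteq> Suc v" using mark(2)[OF y(2) False] by simp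
    then have run: "run w (visit k) (R, m) = (?R, ?m)"
      using bs R u k my sums sums' by (simp add: visit_def aval_const del: aval.simps(1))
    have "based N ?R" by (intro based_upd b) simp_all
    moreover have "\<forall>a. a < 14 * N \<or> 22 * N \<le> a \<longrightarrow> ?m a = m0 a"
      using m0 y len by auto
    moreover have "\<forall>i<length (q @ [y]). ?m (18 * N + i) = (q @ [y]) ! i"
      using queue y by (auto simp: nth_append less_Suc_eq)
    moreover have "\<forall>u\<in>set (q @ [y]). ?m (14 * N + u) = Suc v"
      using mark(1) q(2) y by auto
    moreover have "\<forall>u<4 * N. u \<notin> set (q @ [y]) \<longrightarrow> ?m (14 * N + u) \<le> v"
      using mark(2) by auto
    ultimately have "bfs e m0 v (q @ [y]) h (?R, ?m)"
      using R q y False unfolding bfs_def by simp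
    then show ?thesis
      using runs u False unfolding run by (intro exI[of _ ?R] exI[of _ ?m]) (simp add: enqueue_def)
  qed
qed

lemma bfs_body_run:
  assumes bfs: "bfs e m0 v q h s" and h: "h < length q"
    and closed: "\<forall>x y. graph m0 x y \<longrightarrow> y < 4 * N"
  shows "\<exists>q' s'. runs w bfs_body s bfs_body_time s' \<and> bfs e m0 v q' (Suc h) s' \<and>
    set q' = set q \<union> {y. graph m0 (q ! h) y} \<and> take (Suc h) q' = take (Suc h) q"
proof -
  obtain R m where s: "s = (R, m)" by fastforce
  let ?u = "q ! h" let ?R = "R(9 := ?u, 10 := Suc h)"
  have b: "based N R" and R: "R 10 = h" and q: "distinct q" "set q \<subseteq> {..<4 * N}" and mh: "m (18 * N + h) = ?u"
    using bfs h unfolding bfs_def s by auto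
  have u: "?u < 4 * N" using q(2) h nth_mem by blast
  have len: "length q \<le> 4 * N" using queue_length q by blast
  have "(18 * N + h) mod 2 ^ w = 18 * N + h" "Suc h mod 2 ^ w = Suc h"
    using h len by (auto intro!: mod_word)
  then have pop: "run w bfs_pop s = (?R, m)"
    using b mh R unfolding based_def by (simp add: bfs_pop_def s aval_const del: aval.simps(1))
  have "loop_free bfs_pop" by (simp add: bfs_pop_def)
  then have 1: "runs w bfs_pop s (max_time bfs_pop) (?R, m)"
    using runs_run[of bfs_pop w s] unfolding pop by blast
  have "based N ?R" by (intro based_upd b) simp_all
  then have B: "bfs e m0 v q (Suc h) (?R, m)" "?R 9 = ?u"
    using bfs h unfolding bfs_def s by simp_all
  let ?y1 = "m0 (2 * N + ?u)" and ?y2 = "m0 (6 * N + ?u)" and ?y3 = "m0 (10 * N + ?u)"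
  have g: "graph m0 ?u y \<longleftrightarrow> y = ?y1 \<or> y = ?y2 \<or> y = ?y3" for y
    using u by (simp add: graph_def)
  have y: "?y1 < 4 * N" "?y2 < 4 * N" "?y3 < 4 * N" using closed g by blast+
  have bs: "R 22 = 2 * N \<and> R 26 = 6 * N \<and> R 30 = 10 * N" if "bfs e m0 v q h (R, m)" for q h R m
    using that unfolding bfs_def based_def by simp
  obtain R1 m1 where 2: "runs w (visit 22) (?R, m) (max_time (visit 22)) (R1, m1)"
    and B1: "R1 9 = ?u" "bfs e m0 v (enqueue q ?y1) (Suc h) (R1, m1)"
    using visit_run[OF B u, of 22 "2 * N" ?y1] bs[OF B(1)] y by (auto simp del: fun_upd_apply)
  obtain R2 m2 where 3: "runs w (visit 26) (R1, m1) (max_time (visit 26)) (R2, m2)"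
    and B2: "R2 9 = ?u" "bfs e m0 v (enqueue (enqueue q ?y1) ?y2) (Suc h) (R2, m2)"
    using visit_run[OF B1(2,1) u, of 26 "6 * N" ?y2] bs[OF B1(2)] y by (auto simp del: fun_upd_apply)
  obtain R3 m3 where 4: "runs w (visit 30) (R2, m2) (max_time (visit 30)) (R3, m3)"
    and B3: "bfs e m0 v (enqueue (enqueue (enqueue q ?y1) ?y2) ?y3) (Suc h) (R3, m3)"
    using visit_run[OF B2(2,1) u, of 30 "10 * N" ?y3] bs[OF B2(2)] y by (auto simp del: fun_upd_apply)
  let ?q = "enqueue (enqueue (enqueue q ?y1) ?y2) ?y3"
  have "runs w bfs_body s bfs_body_time (R3, m3)"
    unfolding bfs_body_def bfs_body_time_def
    by (rule runs_Seq[OF 1 runs_Seq[OF 2 runs_Seq[OF 3 4]]])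
  moreover have "set ?q = set q \<union> {y. graph m0 ?u y}" using g by auto
  moreover have "take (Suc h) ?q = take (Suc h) q"
    using h length_enqueue[of q ?y1] length_enqueue[of "enqueue q ?y1" ?y2]
    by (simp add: take_enqueue)
  ultimately show ?thesis using B3 by blast
qed

text \<open>All successors of the nodes before the queue head are queued. Once the head meets the
  tail, the queue is closed under edges and contains \<open>v\<close>; conversely only reachable
  nodes are ever queued.\<close>

lemma bfs_run:
  assumes bfs: "bfs e m0 v [v] 0 s"
    and closed: "\<forall>x y. graph m0 x y \<longrightarrow> y < 4 * N"
  shows "\<exists>q s'. runs w (Loop (Less (Reg 10) (Reg 11)) bfs_body) s
      (loop_time (Less (Reg 10) (Reg 11)) (4 * N) bfs_body_time) s' \<and>
    bfs e m0 v q (length q) s' \<and> set q = {x. (graph m0)\<^sup>*\<^sup>* v x}"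
proof -
  let ?b = "Less (Reg 10) (Reg 11)"
  let ?J = "\<lambda>q s. bfs e m0 v q (fst s 10) s \<and> v \<in> set q \<and> set q \<subseteq> {x. (graph m0)\<^sup>*\<^sup>* v x} \<and>
    (\<forall>x\<in>set (take (fst s 10) q). {y. graph m0 x y} \<subseteq> set q)"
  let ?I = "\<lambda>s. \<exists>q. ?J q s"
  have J: "fst s 11 = length q \<and> fst s 10 \<le> length q \<and> length q \<le> 4 * N" if "?J q s" for q s
    using that queue_length[of q] unfolding bfs_def by blast
  have "\<exists>s'. runs w (Loop ?b bfs_body) s (loop_time ?b (4 * N) bfs_body_time) s' \<and> ?I s' \<and> \<not> bval w ?b s'"
  proof (rule runs_bounded_Loop[where I = ?I and \<mu> = "\<lambda>s. 4 * N - fst s 10"])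
    fix s assume "?I s" and "bval w ?b s"
    then obtain q where q: "?J q s" by blast
    let ?h = "fst s 10"
    have h: "?h < length q" using J[OF q] \<open>bval w ?b s\<close> by simp
    obtain q' s' where s': "runs w bfs_body s bfs_body_time s'" "bfs e m0 v q' (Suc ?h) s'"
      "set q' = set q \<union> {y. graph m0 (q ! ?h) y}" "take (Suc ?h) q' = take (Suc ?h) q"
      using bfs_body_run[OF conjunct1[OF q] h closed] by blast
    have h': "fst s' 10 = Suc ?h" using s'(2) unfolding bfs_def by simp
    have "(graph m0)\<^sup>*\<^sup>* v (q ! ?h)" using q h nth_mem by blast
    then have "{y. graph m0 (q ! ?h) y} \<subseteq> {x. (graph m0)\<^sup>*\<^sup>* v x}"
      by (auto intro: rtranclp.rtrancl_into_rtrancl)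
    moreover have "set (take (Suc ?h) q) = insert (q ! ?h) (set (take ?h q))"
      using h by (simp add: take_Suc_conv_app_nth)
    ultimately have "?J q' s'"
      using q s'(2-4) h' by auto
    moreover have "?h < 4 * N" using h J[OF q] by linarith
    then have "4 * N - fst s' 10 < 4 * N - ?h" unfolding h' by (rule diff_less_mono2[OF lessI])
    ultimately show "\<exists>s'. runs w bfs_body s bfs_body_time s' \<and> ?I s' \<and> 4 * N - fst s' 10 < 4 * N - fst s 10"
      using s'(1) by blast
  next
    have "fst s 10 = 0" using bfs unfolding bfs_def by simp
    then show "?I s" using bfs by (intro exI[of _ "[v]"]) simp
  qed simp
  then obtain s' q where s': "runs w (Loop ?b bfs_body) s (loop_time ?b (4 * N) bfs_body_time) s'"
    "?J q s'" "\<not> bval w ?b s'" by blast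
  then have h: "fst s' 10 = length q" using J[OF s'(2)] by simp
  have "x \<in> set q" if "(graph m0)\<^sup>*\<^sup>* v x" for x
    using that by (induction rule: rtranclp_induct) (use s'(2) h in auto)
  then have "set q = {x. (graph m0)\<^sup>*\<^sup>* v x}" using s'(2) by blast
  then show ?thesis using s'(1,2) h by metis
qed

text \<open>With correct tables and \<open>v\<close> a term, this is \<open>bad v\<close> phrased as
  reachability in memory.\<close>

definition cyclic :: "(nat \<Rightarrow> nat) \<Rightarrow> nat \<Rightarrow> bool" where
  "cyclic m0 v \<longleftrightarrow> (graph m0)\<^sup>*\<^sup>* v (3 * N + v)"

text \<open>
  A pair of mates is only tested at its larger element, when both searches have been made.
\<close>

definition search_inv :: "bool \<Rightarrow> (nat \<Rightarrow> nat) \<Rightarrow> nat \<Rightarrow> state \<Rightarrow> bool" where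
  "search_inv ok m0 v s \<longleftrightarrow> based N (fst s) \<and> fst s 13 = v \<and> v \<le> N \<and>
     fst s 6 = of_bool (ok \<and> \<not> (\<exists>u<v. m0 (5 * N + u) \<le> u \<and> cyclic m0 u \<and> cyclic m0 (m0 (5 * N + u)))) \<and>
     (\<forall>a<14 * N. snd s a = m0 a) \<and> (\<forall>u<4 * N. snd s (14 * N + u) \<le> v) \<and>
     (\<forall>u<N. snd s (22 * N + u) = of_bool (u < v \<and> cyclic m0 u))"

lemma graph_cong: "(\<And>a. a < 14 * N \<Longrightarrow> m a = m0 a) \<Longrightarrow> graph m = graph m0"
  by (auto simp: graph_def fun_eq_iff)

lemma search_init_run:
  assumes inv: "search_inv ok m0 v s" and v: "v < N"
  shows "\<exists>s'. runs w search_init s (max_time search_init) s' \<and> bfs (fst s 6) (snd s) v [v] 0 s'"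
proof -
  obtain R m where s: "s = (R, m)" by fastforce
  have b: "based N R" and R: "R 13 = v" and mark: "\<And>u. u < 4 * N \<Longrightarrow> m (14 * N + u) \<le> v"
    using inv unfolding search_inv_def s by auto
  let ?R = "R(2 := Suc v, 10 := 0, 11 := 1)" and ?m = "m(14 * N + v := Suc v, 18 * N := v)"
  have sums: "(14 * N + v) mod 2 ^ w = 14 * N + v" "Suc v mod 2 ^ w = Suc v"
    using v by (auto intro!: mod_word)
  have lf: "loop_free search_init" by (simp add: search_init_def)
  have run: "run w search_init s = (?R, ?m)"
    using b sums R unfolding based_def by (simp add: search_init_def s aval_const del: aval.simps(1))
  have "based N ?R" by (intro based_upd b) simp_all
  moreover have "\<forall>a. a < 14 * N \<or> 22 * N \<le> a \<longrightarrow> ?m a = m a" using v by auto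
  moreover have "\<forall>u<4 * N. u \<notin> set [v] \<longrightarrow> ?m (14 * N + u) \<le> v" using mark by auto
  ultimately have "bfs (R 6) m v [v] 0 (?R, ?m)"
    using R v unfolding bfs_def by simp
  then show ?thesis
    using runs_run[OF lf, of w s] unfolding run by (auto simp: s)
qed

lemma search_test_run:
  assumes inv: "search_inv ok m0 v s0" and bfs: "bfs (fst s0 6) (snd s0) v q h s"
    and q: "set q = {x. (graph m0)\<^sup>*\<^sup>* v x}" and v: "v < N" and mate: "m0 (5 * N + v) < N"
  shows "search_inv ok m0 (Suc v) (run w search_test s)"
proof -
  obtain R m where s: "s = (R, m)" by fastforce
  let ?k = "m0 (5 * N + v)"
  have b: "based N R" and R: "R 13 = v" "R 6 = fst s0 6" "R 2 = Suc v"
    and keep: "\<And>a. a < 14 * N \<or> 22 * N \<le> a \<Longrightarrow> m a = snd s0 a"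
    and marked: "\<And>u. u \<in> set q \<Longrightarrow> m (14 * N + u) = Suc v"
    and unmarked: "\<And>u. u < 4 * N \<Longrightarrow> u \<notin> set q \<Longrightarrow> m (14 * N + u) \<le> v"
    using bfs unfolding bfs_def s by auto
  have e: "fst s0 6 = of_bool (ok \<and> \<not> (\<exists>u<v. m0 (5 * N + u) \<le> u \<and> cyclic m0 u \<and> cyclic m0 (m0 (5 * N + u))))"
    and m0: "\<And>a. a < 14 * N \<Longrightarrow> m a = m0 a"
    and bad: "\<And>u. u < N \<Longrightarrow> m (22 * N + u) = of_bool (u < v \<and> cyclic m0 u)"
    using inv keep unfolding search_inv_def by auto
  have marks: "m (14 * N + u) \<le> Suc v" if "u < 4 * N" for u
    using marked[of u] unmarked[OF that] by fastforce
  have test: "m (14 * N + (3 * N + v)) = Suc v \<longleftrightarrow> cyclic m0 v"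
    using marked[of "3 * N + v"] unmarked[of "3 * N + v"] q v unfolding cyclic_def by fastforce
  have bs: "R 34 = 14 * N" "R 23 = 3 * N" "R 42 = 22 * N" "R 25 = 5 * N" using b unfolding based_def by simp_all
  have sums: "(3 * N + v) mod 2 ^ w = 3 * N + v" "(14 * N + (3 * N + v)) mod 2 ^ w = 14 * N + (3 * N + v)"
    "(22 * N + v) mod 2 ^ w = 22 * N + v" "(5 * N + v) mod 2 ^ w = 5 * N + v"
    "(22 * N + ?k) mod 2 ^ w = 22 * N + ?k" "Suc v mod 2 ^ w = Suc v"
    using v mate by (auto intro!: mod_word)
  have k: "m (5 * N + v) = ?k" using m0[of "5 * N + v"] v by simp
  let ?m = "if cyclic m0 v then m(22 * N + v := 1) else m"
  let ?R = "if cyclic m0 v \<and> (?k = v \<or> m (22 * N + ?k) = 1) then R(6 := 0) else R"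
  have run: "run w search_test s = (?R(13 := Suc v), ?m)"
  proof (cases "cyclic m0 v")
    case True
    then have t: "m (14 * N + (3 * N + v)) = Suc v" using test by simp
    have "22 * N + v \<noteq> 5 * N + v" using v by simp
    then show ?thesis
      using True t bs sums R k by (simp add: search_test_def s aval_const del: aval.simps(1))
  next
    case False
    then have "m (14 * N + (3 * N + v)) \<noteq> Suc v" using test by simp
    then show ?thesis
      using False bs sums R by (simp add: search_test_def s aval_const del: aval.simps(1))
  qed
  have "m (22 * N + ?k) = 1 \<longleftrightarrow> ?k < v \<and> cyclic m0 ?k" using bad[OF mate] by simp
  \<comment> \<open>The case \<open>?k = v\<close> is the flag just written for \<open>v\<close>
    itself; the flag of a mate larger than \<open>v\<close> is still 0.\<close>
  then have reject: "cyclic m0 v \<and> (?k = v \<or> m (22 * N + ?k) = 1) \<longleftrightarrow> ?k \<le> v \<and> cyclic m0 v \<and> cyclic m0 ?k"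
    by (metis le_neq_implies_less less_or_eq_imp_le)
  have "based N (?R(13 := Suc v))" 
    using based_upd[OF b, of 13 "Suc v"] based_upd[OF based_upd[OF b, of 6 0], of 13 "Suc v"] by auto
  moreover have "(?R(13 := Suc v)) 6 =
      of_bool (ok \<and> \<not> (\<exists>u<Suc v. m0 (5 * N + u) \<le> u \<and> cyclic m0 u \<and> cyclic m0 (m0 (5 * N + u))))"
    unfolding reject using R e by (auto simp: less_Suc_eq)
  moreover have "\<forall>a<14 * N. ?m a = m0 a" using m0 by auto
  moreover have "\<forall>u<4 * N. ?m (14 * N + u) \<le> Suc v" using marks by auto
  moreover have "\<forall>u<N. ?m (22 * N + u) = of_bool (u < Suc v \<and> cyclic m0 u)"
    using bad by (auto simp: less_Suc_eq)
  ultimately show ?thesis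
    using v unfolding run search_inv_def by simp
qed

lemma search_body_run:
  assumes inv: "search_inv ok m0 v s" and v: "v < N" and mate: "m0 (5 * N + v) < N"
    and closed: "\<forall>x y. graph m0 x y \<longrightarrow> y < 4 * N"
  shows "\<exists>s'. runs w search_body s (search_body_time N) s' \<and> search_inv ok m0 (Suc v) s'"
proof -
  have g: "graph (snd s) = graph m0"
    by (rule graph_cong) (use inv in \<open>simp add: search_inv_def\<close>)
  obtain s1 where 1: "runs w search_init s (max_time search_init) s1" "bfs (fst s 6) (snd s) v [v] 0 s1"
    using search_init_run[OF inv v] by blast
  obtain q s2 where 2: "runs w (Loop (Less (Reg 10) (Reg 11)) bfs_body) s1
      (loop_time (Less (Reg 10) (Reg 11)) (4 * N) bfs_body_time) s2"
    "bfs (fst s 6) (snd s) v q (length q) s2" "set q = {x. (graph m0)\<^sup>*\<^sup>* v x}"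
    using bfs_run[OF 1(2)] closed unfolding g by blast
  have "loop_free search_test" by (simp add: search_test_def)
  note 3 = runs_run[OF this, of w s2]
  show ?thesis
    using runs_Seq[OF 1(1) runs_Seq[OF 2(1) 3]] search_test_run[OF inv 2(2,3) v mate]
    unfolding search_body_def search_body_time_def by blast
qed

lemma search_loop_run:
  assumes b: "based N R" and R: "R 6 = of_bool ok"
    and mate: "\<And>v. v < N \<Longrightarrow> m0 (5 * N + v) < N" and closed: "\<forall>x y. graph m0 x y \<longrightarrow> y < 4 * N"
    and z: "\<And>a. 14 * N \<le> a \<Longrightarrow> m0 a = 0"
  shows "\<exists>s'. runs w search_loop (R, m0) (search_time N) s' \<and>
    fst s' 0 = of_bool (ok \<and> \<not> (\<exists>v<N. m0 (5 * N + v) \<le> v \<and> cyclic m0 v \<and> cyclic m0 (m0 (5 * N + v))))"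
proof -
  let ?I = "\<lambda>s. search_inv ok m0 (fst s 13) s" and ?b = "Less (Reg 13) (Reg 0)"
  let ?s = "(R(13 := 0), m0)"
  have 1: "runs w (Assign 13 (Const 0)) (R, m0) (max_time (Assign 13 (Const 0))) ?s"
    using runs_run[of "Assign 13 (Const 0)" w "(R, m0)"] by simp
  have R1: "search_inv ok m0 i s \<Longrightarrow> fst s 13 = i \<and> i \<le> N \<and> fst s 0 = N" for i s
    by (auto simp: search_inv_def based_def)
  have inv: "?I ?s"
    using based_upd[OF b, of 13 0] R z[of "14 * N + u" for u] z[of "22 * N + u" for u] by (simp add: search_inv_def)
  have "\<exists>s'. runs w (Loop ?b search_body) ?s (loop_time ?b N (search_body_time N)) s' \<and> ?I s' \<and> \<not> bval w ?b s'"
  proof (rule runs_bounded_Loop[where I = ?I and \<mu> = "\<lambda>s. N - fst s 13"])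
    fix s assume I: "?I s" and "bval w ?b s"
    then have less: "fst s 13 < N" using R1[OF I] by simp
    obtain s' where s': "runs w search_body s (search_body_time N) s'" "search_inv ok m0 (Suc (fst s 13)) s'"
      using search_body_run[OF I less mate[OF less] closed] by blast
    then show "\<exists>s'. runs w search_body s (search_body_time N) s' \<and> ?I s' \<and> N - fst s' 13 < N - fst s 13"
      using R1[OF s'(2)] diff_less_mono2[OF lessI less] by (intro exI[of _ s']) simp
  qed (use inv in simp_all)
  then obtain s' where s': "runs w (Loop ?b search_body) ?s (loop_time ?b N (search_body_time N)) s'" "?I s'" "\<not> bval w ?b s'"
    by blast
  have "fst s' 13 = N" using R1[OF s'(2)] s'(3) by simp
  then have "fst (run w (Assign 0 (Reg 6)) s') 0 =
      of_bool (ok \<and> \<not> (\<exists>v<N. m0 (5 * N + v) \<le> v \<and> cyclic m0 v \<and> cyclic m0 (m0 (5 * N + v))))"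
    using s'(2) unfolding search_inv_def by simp
  note 2 = this
  have "runs w (Assign 0 (Reg 6)) s' (max_time (Assign 0 (Reg 6))) (run w (Assign 0 (Reg 6)) s')"
    by (rule runs_run) simp
  from runs_Seq[OF 1 runs_Seq[OF s'(1) this]] 2 show ?thesis
    unfolding search_loop_def search_time_def by blast
qed

end

section \<open>The whole program\<close>

definition solver :: com where
  "solver = Seq prelude (Seq parse_loop (Seq link_loop search_loop))"

definition solver_time :: "nat \<Rightarrow> nat" where
  "solver_time N = 1 + max_time prelude + (1 + loop_time (Less (Reg 13) (Reg 0)) N (max_time parse_body) +
     (1 + link_time N + search_time N))"

text \<open>Loops are nested at most two deep, each with linearly many rounds: for every position
  there is one scan for its previous occurrence and one search.\<close>

lemma poly_bounded_solver_time: "poly_bounded (Suc (Suc 0)) solver_time"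
  unfolding solver_time_def link_time_def link_body_time_def
    search_time_def search_body_time_def
  by (intro poly_bounded_add poly_bounded_loop poly_bounded_loop_1 poly_bounded_const)

lemma solver_run:
  assumes short: "\<forall>f\<in>set p. length f \<le> 2" and xs: "xs = encode p" and w: "(length xs + 2) ^ 8 \<le> 2 ^ w"
  shows "\<exists>s. runs w solver (init_state xs) (solver_time (length xs)) s \<and>
    fst s 0 = (if has_multilinear_monomial p then 1 else 0)"
proof -
  define N where "N = length xs"
  have eight: "8 = Suc 7" by simp
  \<comment> \<open>Seven of the eight factors are at least 2, which leaves
    \<open>2 ^ 7 * (N + 2)\<close>, the bound \<open>128 * N + 256\<close> of
    \<open>ram\<close>.\<close>
  have "2 ^ 7 \<le> (N + 2) ^ 7" by (rule power_mono) simp_all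
  then have "2 ^ 7 * (N + 2) \<le> (N + 2) ^ 8"
    unfolding eight power_Suc2 by (rule mult_le_mono1)
  also have "\<dots> \<le> 2 ^ w" using w unfolding N_def .
  finally have "128 * N + 256 \<le> 2 ^ w" by simp
  then interpret ram w N by (rule ram.intro)
  have N: "length xs = N" "0 < N"
    by (simp_all add: N_def xs encode_def)
  obtain R where 1: "runs w prelude (init_state xs) (max_time prelude) (R, snd (init_state xs))"
    and R: "based N R" "R 13 = 1" "R 2 = 0" "R 3 = 0" "R 4 = 0" "R 5 = 0" "R 6 = 1"
    using prelude_run[OF N(1)] by blast
  have "snd (init_state xs) = parse_mem xs (\<lambda>_. 0) (\<lambda>_. 0)"
    by (simp add: init_state_def parse_mem_def fun_eq_iff N(1))
  then have "parse_inv xs 1 (R, snd (init_state xs))"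
    using R N(2) by (auto simp: parse_inv_def)
  then obtain s2 where 2: "runs w parse_loop (R, snd (init_state xs))
      (loop_time (Less (Reg 13) (Reg 0)) N (max_time parse_body)) s2" "parse_inv xs N s2"
    using parse_loop_run by blast
  obtain R2 m2 where s2: "s2 = (R2, m2)" by fastforce
  obtain own mate t c h g ok where parsed: "parsed xs = (own, mate, t, c, h, g, ok)"
    and R2: "based N R2" "R2 6 = of_bool ok" and m2: "m2 = parse_mem xs own mate"
    using 2(2) N(1) unfolding parse_inv_def parsed_def s2 by auto
  note correct = parsed_correct[OF short xs parsed]
  have "layout N own mate" using correct(1) N(1) by simp
  then interpret ram_layout w N "(!) xs" own mate
    unfolding ram_layout_def using ram_axioms by blast
  have inp: "input_mem m2"
    unfolding input_mem_def m2 parse_mem_def by simp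
  have "m2 a = 0" if "2 * N \<le> a" "\<not> (5 * N \<le> a \<and> a < 6 * N)" for a
    using that unfolding m2 parse_mem_def by auto
  then obtain s3 where 3: "runs w link_loop (R2, m2) (link_time N) s3" and inv: "link_inv (of_bool ok) N s3"
    using link_loop_run[OF R2 N(2) inp] by blast
  obtain R3 m3 where s3: "s3 = (R3, m3)" by fastforce
  have R3: "based N R3" "R3 6 = of_bool ok" and inp3: "input_mem m3" and z3: "\<And>a. 14 * N \<le> a \<Longrightarrow> m3 a = 0"
    using inv unfolding link_inv_def s3 by auto
  have edge1: "graph m3 x y \<Longrightarrow> edge x y \<or> y = 0" and edge2: "edge x y \<Longrightarrow> graph m3 x y" for x y
    using graph_edge[OF inv] unfolding s3 by simp_all
  have m3: "m3 (5 * N + v) = mate v" if "v < N" for v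
    using inp3 that unfolding input_mem_def by blast
  have mateN: "mate v < N" for v
    using mate_less[of "mate v"] mate_nz[of v] N(2) by (cases "mate v = 0") auto
  have closed: "\<forall>x y. graph m3 x y \<longrightarrow> y < 4 * N"
  proof (intro allI impI)
    fix x y assume "graph m3 x y"
    from edge1[OF this] show "y < 4 * N" using edge_less[of x y] N(2) by auto
  qed
  have mate3: "m3 (5 * N + v) < N" if "v < N" for v
    unfolding m3[OF that] by (rule mateN)
  obtain s4 where 4: "runs w search_loop (R3, m3) (search_time N) s4"
    and out: "fst s4 0 = of_bool (ok \<and> \<not> (\<exists>v<N. m3 (5 * N + v) \<le> v \<and> cyclic m3 v \<and> cyclic m3 (m3 (5 * N + v))))"
    using search_loop_run[OF R3 mate3 closed z3] by blast
  have "(\<exists>v<N. m3 (5 * N + v) \<le> v \<and> cyclic m3 v \<and> cyclic m3 (m3 (5 * N + v))) \<longleftrightarrow>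
      (\<exists>v<N. cyclic m3 v \<and> cyclic m3 (mate v))"
  proof
    assume "\<exists>v<N. cyclic m3 v \<and> cyclic m3 (mate v)"
    then obtain v where v: "v < N" "cyclic m3 v" "cyclic m3 (mate v)" by blast
    show "\<exists>v<N. m3 (5 * N + v) \<le> v \<and> cyclic m3 v \<and> cyclic m3 (m3 (5 * N + v))"
    proof (cases "mate v \<le> v")
      case True
      then show ?thesis using v m3[OF v(1)] by (intro exI[of _ v]) simp
    next
      \<comment> \<open>The pair is then tested at \<open>mate v\<close>, whose own mate is
        \<open>v\<close> again.\<close>
      case False
      then have "mate v \<noteq> 0" by simp
      then have "mate (mate v) = v" by (rule mate_mate)
      moreover have "m3 (5 * N + mate v) = mate (mate v)" by (rule m3[OF mateN])
      ultimately have "m3 (5 * N + mate v) = v" by (simp only:)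
      then show ?thesis using v False mateN[of v] by (intro exI[of _ "mate v"]) auto
    qed
  next
    assume "\<exists>v<N. m3 (5 * N + v) \<le> v \<and> cyclic m3 v \<and> cyclic m3 (m3 (5 * N + v))"
    then obtain v where v: "v < N" "cyclic m3 v" "cyclic m3 (m3 (5 * N + v))" by blast
    then show "\<exists>v<N. cyclic m3 v \<and> cyclic m3 (mate v)" unfolding m3[OF v(1)] by blast
  qed
  note ordered = this
  have "\<not> (\<exists>S. solution S) \<longleftrightarrow> (\<exists>v<N. cyclic m3 v \<and> cyclic m3 (mate v))"
    unfolding cyclic_def by (rule unsolvable_iff_paths[OF N(2) edge2 edge1])
  then have "\<not> (\<exists>v<N. cyclic m3 v \<and> cyclic m3 (mate v)) \<longleftrightarrow> (\<exists>S. solution S)" by blast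
  then have "fst s4 0 = of_bool (ok \<and> (\<exists>S. solution S))"
    unfolding out ordered by (simp only:)
  moreover have "has_multilinear_monomial p \<longleftrightarrow> ok \<and> (\<exists>S. solution S)"
    by (rule correct(3))
  ultimately have "fst s4 0 = (if has_multilinear_monomial p then 1 else 0)"
    by (simp only: of_bool_def)
  moreover have "runs w solver (init_state xs) (solver_time N) s4"
    unfolding solver_def solver_time_def
    using runs_Seq[OF 1 runs_Seq[OF 2(1)[unfolded s2] runs_Seq[OF 3[unfolded s3] 4]]] .
  ultimately show ?thesis unfolding N_def by blast
qed

theorem theorem4:
  "quadratic_time_decidable encode (\<Union>n m t. pi_sigma_pi n m 2 t) has_multilinear_monomial"
proof -
  obtain c where c: "\<And>n. 0 < n \<Longrightarrow> solver_time n \<le> c * n ^ 2"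
    using poly_bounded_solver_time unfolding poly_bounded_def numeral_2_eq_2 by blast
  have "\<exists>T s. exec w solver (init_state (encode p)) T s \<and> T \<le> c * length (encode p) ^ 2 \<and>
      fst s 0 = (if has_multilinear_monomial p then 1 else 0)"
    if p: "p \<in> (\<Union>n m t. pi_sigma_pi n m 2 t)" and w: "(length (encode p) + 2) ^ 8 \<le> 2 ^ w" for p w
  proof -
    have "\<forall>f\<in>set p. length f \<le> 2" using p by (auto simp: pi_sigma_pi_def)
    then obtain s where s: "runs w solver (init_state (encode p)) (solver_time (length (encode p))) s"
      "fst s 0 = (if has_multilinear_monomial p then 1 else 0)"
      using solver_run[OF _ refl w] by blast
    obtain T where "T \<le> solver_time (length (encode p))" "exec w solver (init_state (encode p)) T s"
      using s(1) unfolding runs_def by blast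
    moreover have "solver_time (length (encode p)) \<le> c * length (encode p) ^ 2"
      by (rule c) (simp add: encode_def)
    ultimately show ?thesis using s(2) le_trans by blast
  qed
  then show ?thesis
    unfolding quadratic_time_decidable_def decides_in_time_def by blast
qed

end
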